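(* Let $Z\subset\mathbb{S}_8$ be a finite nonempty set of points. Then $\alpha(Z)=\alpha(2Z)=1$ if and only if $Z=\{Q\}$ for a single point $Q$ such that $f(Q)$ is the singular point of an irreducible cubic curve $F$ passing through $P_1,\dots,P_8$ and $f(Q)\neq P_i$ for all $i\in\{1,\dots,8\}$.
   Context: Let $P_1,\dots,P_8\in\mathbb{P}^2(\mathbb{C})$ be eight general points and $f\colon\mathbb{S}_8\to\mathbb{P}^2$ the blow-up at them, with exceptional curves $E_i=f^{-1}(P_i)$; let $H$ be the pullback of the class of a line and $\mathbb{L}_8=3H-E_1-\dots-E_8=-K_{\mathbb{S}_8}$. For a finite set $Z\subset\mathbb{S}_8$ with ideal sheaf $\mathcal{I}_Z$ and a positive integer $m$, $\alpha(mZ)=\min\{d\ge 0:\ H^0(\mathbb{S}_8,d\mathbb{L}_8\otimes\mathcal{I}_Z^{(m)})\neq 0\}$, i.e. the least $d$ such that some effective divisor $D\in|d\mathbb{L}_8|$ has multiplicity at least $m$ at every point of $Z$. *)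

theory Defs
  imports "HOL-Analysis.Analysis" "HOL-Library.Poly_Mapping" "HOL-Computational_Algebra.Factorial_Ring"
begin

text \<open>Vectors of C^3 (homogeneous coordinates of points of P^2).\<close>
type_synonym cvec = "complex \<times> complex \<times> complex"

text \<open>Multivariate polynomials with complex coefficients: variable i has exponent
  Poly_Mapping.lookup e i in the monomial e.  Plane curves use variables 0,1,2.\<close>
type_synonym mpoly = "(nat \<Rightarrow>\<^sub>0 nat) \<Rightarrow>\<^sub>0 complex"

definition cc :: "cvec \<Rightarrow> nat \<Rightarrow> complex" where
  "cc v i = (case v of (a, b, c) \<Rightarrow> if i = 0 then a else if i = 1 then b else c)"

definition vadd :: "cvec \<Rightarrow> cvec \<Rightarrow> cvec" where
  "vadd u v = (case u of (a, b, c) \<Rightarrow> case v of (a', b', c') \<Rightarrow> (a + a', b + b', c + c'))"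

definition vscale :: "complex \<Rightarrow> cvec \<Rightarrow> cvec" where
  "vscale s v = (case v of (a, b, c) \<Rightarrow> (s * a, s * b, s * c))"

definition dot3 :: "cvec \<Rightarrow> cvec \<Rightarrow> complex" where
  "dot3 u v = cc u 0 * cc v 0 + cc u 1 * cc v 1 + cc u 2 * cc v 2"

definition det3 :: "cvec \<Rightarrow> cvec \<Rightarrow> cvec \<Rightarrow> complex" where
  "det3 u v w =
     cc u 0 * (cc v 1 * cc w 2 - cc v 2 * cc w 1)
   - cc u 1 * (cc v 0 * cc w 2 - cc v 2 * cc w 0)
   + cc u 2 * (cc v 0 * cc w 1 - cc v 1 * cc w 0)"

text \<open>Canonical representative of a point of P^2 (or of the dual P^2):
  the last nonzero homogeneous coordinate equals 1.\<close>
definition normalized :: "cvec \<Rightarrow> bool" where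
  "normalized v \<longleftrightarrow> cc v 2 = 1 \<or> (cc v 2 = 0 \<and> cc v 1 = 1) \<or> (cc v 2 = 0 \<and> cc v 1 = 0 \<and> cc v 0 = 1)"

definition meval :: "mpoly \<Rightarrow> (nat \<Rightarrow> complex) \<Rightarrow> complex" where
  "meval F x = (\<Sum>m\<in>Poly_Mapping.keys F. Poly_Mapping.lookup F m * (\<Prod>i\<in>Poly_Mapping.keys m. x i ^ Poly_Mapping.lookup m i))"

definition peval :: "mpoly \<Rightarrow> cvec \<Rightarrow> complex" where
  "peval F v = meval F (cc v)"

definition homog :: "nat \<Rightarrow> mpoly \<Rightarrow> bool" where
  "homog n F \<longleftrightarrow> (\<forall>m\<in>Poly_Mapping.keys F. Poly_Mapping.keys m \<subseteq> {0, 1, 2} \<and> (\<Sum>i\<in>{0, 1, 2 :: nat}. Poly_Mapping.lookup m i) = n)"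

definition ord2 :: "(complex \<Rightarrow> complex \<Rightarrow> complex) \<Rightarrow> nat" where
  "ord2 h = (LEAST n. \<exists>k j. k + j = n \<and>
      (deriv ^^ k) (\<lambda>x. (deriv ^^ j) (\<lambda>y. h x y) 0) 0 \<noteq> 0)"

text \<open>Multiplicity at the point p of P^2 of the plane curve F = 0,
  computed in affine coordinates p + xA + yB centred at p.\<close>
definition curve_mult :: "mpoly \<Rightarrow> cvec \<Rightarrow> nat" where
  "curve_mult F p = (let AB = (SOME AB. det3 p (fst AB) (snd AB) \<noteq> 0) in
      ord2 (\<lambda>x y. peval F (vadd p (vadd (vscale x (fst AB)) (vscale y (snd AB))))))"

text \<open>For the point of the exceptional curve over P given by the line L through P
  (tangent direction of L at P): order at (0,0) of F in the blow-up chart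
  (x,t) \<mapsto> P + xR + xtB, where R \<noteq> P lies on L and B is off L.
  The multiplicity of f^*F - d(E_1+...+E_8) at that point is this order minus d.\<close>
definition exc_ord :: "mpoly \<Rightarrow> cvec \<Rightarrow> cvec \<Rightarrow> nat" where
  "exc_ord F P L = (let RB = (SOME RB. dot3 L (fst RB) = 0 \<and> dot3 L (snd RB) \<noteq> 0
                                       \<and> det3 P (fst RB) (snd RB) \<noteq> 0) in
      ord2 (\<lambda>x t. peval F (vadd P (vadd (vscale x (fst RB)) (vscale (x * t) (snd RB))))))"

text \<open>Points of the blow-up S_8: Pt p is a point p of P^2 off the P_i (so f(Pt p) = p);
  Ex i L is the point of E_i corresponding to the line L through P_i (so f(Ex i L) = P_i).\<close>
datatype s8pt = Pt cvec | Ex nat cvec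

definition S8 :: "(nat \<Rightarrow> cvec) \<Rightarrow> s8pt set" where
  "S8 Ps = {Pt p | p. normalized p \<and> (\<forall>i\<in>{1..8}. p \<noteq> Ps i)}
         \<union> {Ex i L | i L. i \<in> {1..8} \<and> normalized L \<and> dot3 L (Ps i) = 0}"

text \<open>Nonzero sections of dL_8 = homogeneous polynomials of degree 3d with
  multiplicity at least d at each P_i (up to scalars these are the divisors in |dL_8|).\<close>
definition is_section :: "(nat \<Rightarrow> cvec) \<Rightarrow> nat \<Rightarrow> mpoly \<Rightarrow> bool" where
  "is_section Ps d F \<longleftrightarrow> F \<noteq> 0 \<and> homog (3 * d) F \<and> (\<forall>i\<in>{1..8}. d \<le> curve_mult F (Ps i))"

text \<open>Multiplicity of the divisor D = f^*(F=0) - d(E_1+...+E_8) at a point of S_8.\<close>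
fun div_mult :: "(nat \<Rightarrow> cvec) \<Rightarrow> nat \<Rightarrow> mpoly \<Rightarrow> s8pt \<Rightarrow> nat" where
  "div_mult Ps d F (Pt p) = curve_mult F p"
| "div_mult Ps d F (Ex i L) = exc_ord F (Ps i) L - d"

definition alpha :: "(nat \<Rightarrow> cvec) \<Rightarrow> nat \<Rightarrow> s8pt set \<Rightarrow> nat" where
  "alpha Ps m Z = (LEAST d. \<exists>F. is_section Ps d F \<and> (\<forall>q\<in>Z. m \<le> div_mult Ps d F q))"

definition config :: "(nat \<Rightarrow> complex) \<Rightarrow> nat \<Rightarrow> cvec" where
  "config x i = (x (2 * i), x (2 * i + 1), 1)"

end

theory Submission
  imports Defs "HOL-Computational_Algebra.Polynomial"
begin

text \<open>General position means: no three of the \<open>P_i\<close> on a line, no six on a conic, and no cubic through all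
  of them singular at one of them. In each case the condition is that certain monomials, centred at one of the
  points, have a nonzero alternant at the others; these alternants are nonzero polynomials in the coordinates.
  If a cubic through the eight points has a double point on the blow-up lying on \<open>E_i\<close>, then it is singular
  at \<open>P_i\<close>, which is excluded. If it is reducible, or has two singular points (and hence contains the line
  joining them), it is a line plus a conic, and these contain at most \<open>2 + 5 < 8\<close> of the points. So \<open>Z\<close> is a
  single point off the \<open>P_i\<close> and the cubic is irreducible.

  Since \<open>alpha\<close> is a \<open>LEAST\<close>, \<open>alpha (config x) 2 Z = 1\<close> carries information only if some degree is
  admissible at all: a product of squares of cubics through the eight points and one point of \<open>Z\<close> each shows
  this.\<close>

subsection \<open>Evaluation of polynomials\<close>

text \<open>The multiplicities are least orders of iterated partial derivatives, in a frame picked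
  by \<open>SOME\<close>. No independence of the frame is proved: each statement works in the frame
  of the definition and uses only its nondegeneracy. In such a chart a form becomes a bivariate
  polynomial, whose order is the least total degree of a nonzero coefficient. For the zero function
  \<open>LEAST\<close> ranges over an empty set, so every order estimate is paired with a point
  where the form does not vanish. Centring the monomials at one of the points produces the counts 2,
  5 and 7. The condition at the centre removes the constant term of a line or conic, and from a
  singular cubic the constant and both linear terms; the other points must kill the rest. For the
  cubic 10 - 3 = 7 coefficients remain, as many as there are other points. At a point of E_i a
  double point of the divisor means order at least 3 of the pulled back cubic, as E_i is subtracted
  once. This degree also reaches the derivative transversal to the chosen tangent direction.\<close>

definition mon :: "(nat \<Rightarrow> 'r::comm_ring_1) \<Rightarrow> (nat \<Rightarrow>\<^sub>0 nat) \<Rightarrow> 'r" where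
  "mon X m = (\<Prod>i\<in>Poly_Mapping.keys m. X i ^ Poly_Mapping.lookup m i)"

text \<open>The target ring is arbitrary so that one construction yields complex values,
  restrictions to lines, chart polynomials and the grading by degree.\<close>

definition ev :: "(complex \<Rightarrow> 'r) \<Rightarrow> (nat \<Rightarrow> 'r::comm_ring_1) \<Rightarrow> mpoly \<Rightarrow> 'r" where
  "ev \<kappa> X F = (\<Sum>m\<in>Poly_Mapping.keys F. \<kappa> (Poly_Mapping.lookup F m) * mon X m)"

definition wt :: "(nat \<Rightarrow>\<^sub>0 nat) \<Rightarrow> nat" where
  "wt m = (\<Sum>i\<in>Poly_Mapping.keys m. Poly_Mapping.lookup m i)"

definition Var :: "nat \<Rightarrow> mpoly" where
  "Var i = Poly_Mapping.single (Poly_Mapping.single i 1) 1"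

lemma meval_eq_ev: "meval F x = ev (\<lambda>c. c) x F"
  by (simp add: meval_def ev_def mon_def)

lemma mon_superset:
  assumes "finite S" "Poly_Mapping.keys m \<subseteq> S"
  shows "mon X m = (\<Prod>i\<in>S. X i ^ Poly_Mapping.lookup m i)"
  unfolding mon_def
  by (rule prod.mono_neutral_left) (use assms in \<open>auto simp: in_keys_iff\<close>)

lemma wt_superset:
  assumes "finite S" "Poly_Mapping.keys m \<subseteq> S"
  shows "wt m = (\<Sum>i\<in>S. Poly_Mapping.lookup m i)"
  unfolding wt_def
  by (rule sum.mono_neutral_left) (use assms in \<open>auto simp: in_keys_iff\<close>)

lemma mon_add: "mon X (m + m') = mon X m * mon X m'"
proof -
  let ?S = "Poly_Mapping.keys m \<union> Poly_Mapping.keys m'"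
  have "Poly_Mapping.keys (m + m') \<subseteq> ?S" by (rule Poly_Mapping.keys_add)
  then show ?thesis
    by (simp add: mon_superset[of ?S] lookup_add power_add prod.distrib)
qed

lemma wt_add: "wt (m + m') = wt m + wt m'"
proof -
  let ?S = "Poly_Mapping.keys m \<union> Poly_Mapping.keys m'"
  have "Poly_Mapping.keys (m + m') \<subseteq> ?S" by (rule Poly_Mapping.keys_add)
  then show ?thesis
    by (simp add: wt_superset[of ?S] lookup_add sum.distrib)
qed

lemma mon_0 [simp]: "mon X 0 = 1" and wt_0 [simp]: "wt 0 = 0"
  by (simp_all add: mon_def wt_def)

lemma mon_single [simp]: "mon X (Poly_Mapping.single i n) = X i ^ n"
  by (simp add: mon_def)

lemma wt_single [simp]: "wt (Poly_Mapping.single i n) = n"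
  by (simp add: wt_def)

lemma mon_scale: "mon (\<lambda>i. c * X i) m = c ^ wt m * mon X m"
  by (simp add: mon_def wt_def power_mult_distrib prod.distrib power_sum)

lemma wt_eq_0_iff: "wt m = 0 \<longleftrightarrow> m = 0"
  by (auto simp: wt_def in_keys_iff intro!: poly_mapping_eqI)

lemma wt_Suc_decompose:
  assumes "wt m = Suc n"
  obtains i m' where "m = Poly_Mapping.single i 1 + m'" "wt m' = n"
proof -
  from assms have "m \<noteq> 0" by auto
  then obtain i where i: "i \<in> Poly_Mapping.keys m"
    using keys_eq_empty by blast
  define m' where "m' = m - Poly_Mapping.single i 1"
  have "Poly_Mapping.lookup m k = (1 when i = k) + Poly_Mapping.lookup m' k" for k
    using i by (auto simp: m'_def lookup_minus lookup_single when_def in_keys_iff)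
  then have m: "m = Poly_Mapping.single i 1 + m'"
    by (intro poly_mapping_eqI) (simp add: lookup_add lookup_single)
  moreover have "wt m' = n" using assms by (simp add: m wt_add)
  ultimately show ?thesis by (rule that)
qed

lemma poly_mapping_as_sum:
  "(F :: mpoly) = (\<Sum>m\<in>Poly_Mapping.keys F. Poly_Mapping.single m (Poly_Mapping.lookup F m))"
proof (rule poly_mapping_eqI)
  fix k
  show "Poly_Mapping.lookup F k = Poly_Mapping.lookup (\<Sum>m\<in>Poly_Mapping.keys F. Poly_Mapping.single m (Poly_Mapping.lookup F m)) k"
    by (auto simp: lookup_sum lookup_single when_def sum.delta in_keys_iff cong: if_cong)
qed

locale coeff_hom =
  fixes \<kappa> :: "complex \<Rightarrow> 'r::comm_ring_1"
  assumes hom_add: "\<kappa> (a + b) = \<kappa> a + \<kappa> b"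
    and hom_mult: "\<kappa> (a * b) = \<kappa> a * \<kappa> b"
    and hom_1: "\<kappa> 1 = 1"
begin

lemma hom_0: "\<kappa> 0 = 0"
  using hom_add[of 0 0] by simp

lemma ev_superset:
  assumes "finite M" "Poly_Mapping.keys F \<subseteq> M"
  shows "ev \<kappa> X F = (\<Sum>m\<in>M. \<kappa> (Poly_Mapping.lookup F m) * mon X m)"
  unfolding ev_def
  by (rule sum.mono_neutral_left) (use assms hom_0 in \<open>auto simp: in_keys_iff\<close>)

lemma ev_add: "ev \<kappa> X (F + G) = ev \<kappa> X F + ev \<kappa> X G"
proof -
  let ?S = "Poly_Mapping.keys F \<union> Poly_Mapping.keys G"
  have "Poly_Mapping.keys (F + G) \<subseteq> ?S" by (rule Poly_Mapping.keys_add)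
  then show ?thesis
    by (simp add: ev_superset[of ?S] lookup_add hom_add sum.distrib algebra_simps)
qed

lemma ev_0: "ev \<kappa> X 0 = 0"
  by (simp add: ev_def)

lemma ev_sum: "ev \<kappa> X (\<Sum>a\<in>A. f a) = (\<Sum>a\<in>A. ev \<kappa> X (f a))"
  by (induction A rule: infinite_finite_induct) (simp_all add: ev_0 ev_add)

lemma ev_single: "ev \<kappa> X (Poly_Mapping.single m c) = \<kappa> c * mon X m"
  by (cases "c = 0") (simp_all add: ev_def hom_0)

lemma ev_mult: "ev \<kappa> X (F * G) = ev \<kappa> X F * ev \<kappa> X G"
proof -
  have "F * G = (\<Sum>a\<in>Poly_Mapping.keys F. \<Sum>b\<in>Poly_Mapping.keys G.
      Poly_Mapping.single (a + b) (Poly_Mapping.lookup F a * Poly_Mapping.lookup G b))"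
    by (subst poly_mapping_as_sum[of F], subst poly_mapping_as_sum[of G])
       (simp add: sum_product mult_single)
  then show ?thesis
    by (simp add: ev_sum ev_single hom_mult mon_add)
       (simp add: ev_def sum_product algebra_simps)
qed

lemma ev_1: "ev \<kappa> X 1 = 1"
  using ev_single[of X 0 1] by (simp add: hom_1)

lemma ev_Var: "ev \<kappa> X (Var i) = X i"
  by (simp add: Var_def ev_single hom_1)

lemma ev_prod: "ev \<kappa> X (\<Prod>a\<in>A. f a) = (\<Prod>a\<in>A. ev \<kappa> X (f a))"
  by (induction A rule: infinite_finite_induct) (simp_all add: ev_1 ev_mult)

lemma ev_power: "ev \<kappa> X (F ^ n) = ev \<kappa> X F ^ n"
  by (induction n) (simp_all add: ev_1 ev_mult)

lemma ev_minus: "ev \<kappa> X (F - G) = ev \<kappa> X F - ev \<kappa> X G"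
  using ev_add[of X "F - G" G] by (simp add: algebra_simps)

lemma ev_of_int: "ev \<kappa> X (of_int n) = of_int n"
proof (induction n rule: int_induct[where k = 0])
  case base show ?case by (simp add: ev_0)
next
  case (step1 i) then show ?case by (simp add: ev_add ev_1)
next
  case (step2 i) then show ?case by (simp add: ev_minus ev_1)
qed

lemma ev_det:
  "ev \<kappa> X (det (M :: mpoly ^ 'n ^ 'n)) = det (\<chi> a b. ev \<kappa> X (M $ a $ b))"
  by (simp add: det_def ev_sum ev_mult ev_of_int ev_prod)

end

interpretation meval: coeff_hom "\<lambda>c. c"
  by standard simp_all

text \<open>Since \<open>\<psi>\<close> respects sums and products, it moves onto coefficients and
  variables. With \<open>\<psi>\<close> an evaluation of polynomials, this identifies the polynomial
  attached to a line or a chart with the values of \<open>F\<close> there.\<close>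

lemma hom_ev:
  assumes "\<And>a b. \<psi> (a + b) = \<psi> a + \<psi> b" "\<And>a b. \<psi> (a * b) = \<psi> a * \<psi> b"
    "\<psi> 0 = 0" "\<psi> 1 = 1"
  shows "\<psi> (ev \<kappa> X F) = ev (\<lambda>c. \<psi> (\<kappa> c)) (\<lambda>i. \<psi> (X i)) F"
proof -
  have pw: "\<psi> (x ^ n) = \<psi> x ^ n" for x n
    by (induction n) (simp_all add: assms)
  have pr: "\<psi> (\<Prod>a\<in>A. f a) = (\<Prod>a\<in>A. \<psi> (f a))" for A :: "nat set" and f
    by (induction A rule: infinite_finite_induct) (simp_all add: assms)
  have sm: "\<psi> (\<Sum>a\<in>A. f a) = (\<Sum>a\<in>A. \<psi> (f a))" for A :: "(nat \<Rightarrow>\<^sub>0 nat) set" and f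
    by (induction A rule: infinite_finite_induct) (simp_all add: assms)
  show ?thesis
    by (simp add: ev_def mon_def pw pr sm assms(2))
qed

subsection \<open>Orders of vanishing\<close>

text \<open>A bivariate polynomial is encoded with the second variable as the outer one.\<close>
definition poly2 :: "complex poly poly \<Rightarrow> complex \<Rightarrow> complex \<Rightarrow> complex" where
  "poly2 H x y = poly (poly H [:y:]) x"

lemma poly2_add: "poly2 (H + K) x y = poly2 H x y + poly2 K x y"
  and poly2_mult: "poly2 (H * K) x y = poly2 H x y * poly2 K x y"
  and poly2_0: "poly2 0 x y = 0"
  and poly2_1: "poly2 1 x y = 1"
  by (simp_all add: poly2_def)

lemma poly2_eq_poly_map_poly: "poly2 H x y = poly (map_poly (\<lambda>c. poly c x) H) y"
  unfolding poly2_def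
  by (induction H) (simp_all add: map_poly_pCons)

lemma higher_deriv_poly: "(deriv ^^ n) (poly q) = poly ((pderiv ^^ n) (q :: complex poly))"
proof (induction n)
  case (Suc n)
  have "deriv (poly p) = poly (pderiv p)" for p :: "complex poly"
    by (rule ext) (simp add: poly_DERIV DERIV_imp_deriv)
  with Suc show ?case by simp
qed simp

lemma higher_deriv_poly_0: "(deriv ^^ n) (poly q) 0 = fact n * coeff (q :: complex poly) n"
  by (simp add: higher_deriv_poly poly_0_coeff_0 coeff_higher_pderiv pochhammer_fact mult.commute)

text \<open>The inner derivatives at \<open>y = 0\<close> leave \<open>fact j\<close> times the
  coefficient of \<open>y^j\<close>, a polynomial in \<open>x\<close>, and the outer ones isolate a
  single coefficient of it. This turns the analytic \<open>ord2\<close> into a statement about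
  coefficients.\<close>

lemma mixed_deriv_poly2:
  "(deriv ^^ k) (\<lambda>x. (deriv ^^ j) (\<lambda>y. poly2 H x y) 0) 0 = fact k * fact j * coeff (coeff H j) k"
proof -
  have "(\<lambda>x. (deriv ^^ j) (\<lambda>y. poly2 H x y) 0) = poly (smult (fact j) (coeff H j))"
    by (rule ext)
      (simp add: poly2_eq_poly_map_poly higher_deriv_poly_0[of j] coeff_map_poly)
  then show ?thesis by (simp add: higher_deriv_poly_0)
qed

definition vanishes :: "nat \<Rightarrow> (complex \<Rightarrow> complex \<Rightarrow> complex) \<Rightarrow> bool" where
  "vanishes n h \<longleftrightarrow> (\<exists>H. (\<forall>x y. h x y = poly2 H x y) \<and> (\<forall>k j. k + j < n \<longrightarrow> coeff (coeff H j) k = 0))"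

text \<open>A nonzero value makes some coefficient nonzero, so the \<open>LEAST\<close> in
  \<open>ord2\<close> is attained; for the zero function its value would be unspecified.\<close>

lemma ord2_ge_iff:
  assumes h: "\<And>x y. h x y = poly2 H x y" and nz: "h x0 y0 \<noteq> 0"
  shows "n \<le> ord2 h \<longleftrightarrow> (\<forall>k j. k + j < n \<longrightarrow> coeff (coeff H j) k = 0)"
proof -
  have "h = poly2 H" using h by blast
  then have ord: "ord2 h = (LEAST n. \<exists>k j. k + j = n \<and> coeff (coeff H j) k \<noteq> 0)"
    unfolding ord2_def by (simp add: mixed_deriv_poly2[unfolded eta_contract_eq])
  have "H \<noteq> 0" using h nz by (auto simp: poly2_0)
  then obtain j where "coeff H j \<noteq> 0" by (meson leading_coeff_0_iff)
  then obtain k where "coeff (coeff H j) k \<noteq> 0" by (meson leading_coeff_0_iff)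
  then have ex: "\<exists>n k j. k + j = n \<and> coeff (coeff H j) k \<noteq> 0" by blast
  show ?thesis
  proof
    assume n: "n \<le> ord2 h"
    show "\<forall>k j. k + j < n \<longrightarrow> coeff (coeff H j) k = 0"
    proof (intro allI impI)
      fix k j assume "k + j < n"
      with n have "k + j < ord2 h" by simp
      from not_less_Least[OF this[unfolded ord]] show "coeff (coeff H j) k = 0" by blast
    qed
  next
    assume R: "\<forall>k j. k + j < n \<longrightarrow> coeff (coeff H j) k = 0"
    show "n \<le> ord2 h"
      using LeastI_ex[OF ex] R unfolding ord by (metis not_le)
  qed
qed

lemma ord2_ge_iff_vanishes:
  assumes h: "\<And>x y. h x y = poly2 H x y" and nz: "h x0 y0 \<noteq> 0"
  shows "n \<le> ord2 h \<longleftrightarrow> vanishes n h"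
  using ord2_ge_iff[of h _ x0 y0 n] assms unfolding vanishes_def by metis

lemma vanishes_mult:
  assumes "vanishes n h" "vanishes m h'"
  shows "vanishes (n + m) (\<lambda>x y. h x y * h' x y)"
proof -
  obtain H H' where H: "\<forall>x y. h x y = poly2 H x y" "\<forall>k j. k + j < n \<longrightarrow> coeff (coeff H j) k = 0"
    and H': "\<forall>x y. h' x y = poly2 H' x y" "\<forall>k j. k + j < m \<longrightarrow> coeff (coeff H' j) k = 0"
    using assms unfolding vanishes_def by metis
  have "coeff (coeff (H * H') j) k = 0" if "k + j < n + m" for k j
  proof -
    have "coeff (coeff H a) b * coeff (coeff H' (j - a)) (k - b) = 0" if "a \<le> j" "b \<le> k" for a b
    proof -
      \<comment> \<open>Below total degree \<open>n + m\<close> the two index pairs cannot both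
        reach their thresholds.\<close>
      have "b + a < n \<or> (k - b) + (j - a) < m" using that \<open>k + j < n + m\<close> by linarith
      then show ?thesis using H(2) H'(2) by auto
    qed
    then show ?thesis
      unfolding coeff_mult coeff_sum by (intro sum.neutral ballI) simp
  qed
  then show ?thesis
    unfolding vanishes_def using H(1) H'(1) by (intro exI[of _ "H * H'"]) (simp add: poly2_mult)
qed

subsection \<open>Generic points\<close>

text \<open>A maximal independent set \<open>B\<close> of value vectors is realized among the rows.
  A kernel vector of the matrix then annihilates \<open>B\<close>, hence every value vector, and so
  is a linear relation between the functions.\<close>

lemma exists_nonsingular_evaluation:
  fixes f :: "'n::finite \<Rightarrow> 's \<Rightarrow> complex"
  assumes indep: "\<And>c. (\<And>s. (\<Sum>b\<in>UNIV. c b * f b s) = 0) \<Longrightarrow> (\<And>b. c b = 0)"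
  shows "\<exists>s. det (\<chi> a b. f b (s a)) \<noteq> 0"
proof -
  define v where "v s = (\<chi> b. f b s)" for s
  obtain B where B: "B \<subseteq> range v" "vec.independent B" "range v \<subseteq> vec.span B"
    using vec.maximal_independent_subset[of "range v"] by blast
  have fin: "finite B" using B(2) by (rule vec.finiteI_independent)
  have "card B \<le> vec.dim (UNIV :: (complex^'n) set)"
    by (rule vec.independent_card_le_dim[OF subset_UNIV B(2)])
  then have card: "card B \<le> CARD('n)" by (simp add: card_cart_basis)
  have "B \<noteq> {}"
  proof
    assume "B = {}"
    then have "v s = 0" for s using B(3) by auto
    then have "f b s = 0" for b s by (metis v_def vec_lambda_beta zero_index)
    then have "(\<Sum>b\<in>UNIV. 1 * f b s) = 0" for s by simp
    from indep[of "\<lambda>_. 1", OF this] show False by simp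
  qed
  obtain \<iota> :: "complex^'n \<Rightarrow> 'n" where \<iota>: "inj_on \<iota> B"
    using card_le_inj[of B "UNIV :: 'n set"] fin card by auto
  define t where "t w = (SOME s. v s = w)" for w
  have t: "v (t w) = w" if "w \<in> B" for w
    unfolding t_def using that B(1) by (metis (mono_tags, lifting) imageE someI subsetD)
  \<comment> \<open>Rows whose index is not hit by \<open>\<iota>\<close> come from arbitrary
    points; the kernel argument only consults the rows in \<open>B\<close>.\<close>
  define s where "s a = t (inv_into B \<iota> a)" for a
  have s: "v (s (\<iota> w)) = w" if "w \<in> B" for w
    using that \<iota> t by (simp add: s_def)
  let ?A = "\<chi> a b. f b (s a)"
  have "det ?A \<noteq> 0"
  proof
    assume "det ?A = 0"
    then have "\<not> invertible ?A" by (simp add: invertible_det_nz)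
    then obtain c where c: "?A *v c = 0" "c \<noteq> 0"
      using matrix_left_invertible_ker[of ?A] invertible_left_inverse[of ?A] by blast
    have ker: "(\<Sum>b\<in>UNIV. w $ b * c $ b) = 0" if "w \<in> B" for w
    proof -
      have "(?A *v c) $ \<iota> w = (\<Sum>b\<in>UNIV. v (s (\<iota> w)) $ b * c $ b)"
        by (simp add: matrix_vector_mult_def v_def)
      then show ?thesis using c(1) s[OF that] by simp
    qed
    have "vec.subspace {w. (\<Sum>b\<in>UNIV. w $ b * c $ b) = 0}"
      unfolding vec.subspace_def
      by (auto simp: distrib_right sum.distrib mult.assoc simp flip: sum_distrib_left)
    then have "vec.span B \<subseteq> {w. (\<Sum>b\<in>UNIV. w $ b * c $ b) = 0}"
      using ker by (intro vec.span_minimal) auto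
    then have "(\<Sum>b\<in>UNIV. v s $ b * c $ b) = 0" for s
      using B(3) by blast
    then have "(\<Sum>b\<in>UNIV. c $ b * f b s) = 0" for s
      by (simp add: v_def mult.commute)
    from indep[of "\<lambda>b. c $ b", OF this] have "c = 0" by (simp add: vec_eq_iff)
    with c(2) show False by simp
  qed
  then show ?thesis by blast
qed

section \<open>Polynomials in the coordinates of the eight points, and their alternants\<close>

definition vars_in :: "nat set \<Rightarrow> mpoly \<Rightarrow> bool" where
  "vars_in S g \<longleftrightarrow> (\<forall>m\<in>Poly_Mapping.keys g. Poly_Mapping.keys m \<subseteq> S)"

lemma vars_in_Var: "i \<in> S \<Longrightarrow> vars_in S (Var i)"
  by (simp add: vars_in_def Var_def)

lemma vars_in_0: "vars_in S 0" and vars_in_1: "vars_in S 1"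
  by (simp_all add: vars_in_def)

lemma vars_in_add: "vars_in S f \<Longrightarrow> vars_in S g \<Longrightarrow> vars_in S (f + g)"
  using Poly_Mapping.keys_add[of f g] unfolding vars_in_def by blast

lemma vars_in_minus: "vars_in S f \<Longrightarrow> vars_in S g \<Longrightarrow> vars_in S (f - g)"
  using keys_diff[of f g] unfolding vars_in_def by blast

lemma vars_in_mult:
  assumes "vars_in S f" "vars_in S g"
  shows "vars_in S (f * g)"
  unfolding vars_in_def
proof
  fix m assume "m \<in> Poly_Mapping.keys (f * g)"
  then obtain a b where "m = a + b" "a \<in> Poly_Mapping.keys f" "b \<in> Poly_Mapping.keys g"
    using keys_mult[of f g] by blast
  then show "Poly_Mapping.keys m \<subseteq> S"
    using assms Poly_Mapping.keys_add[of a b] unfolding vars_in_def by blast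
qed

lemma vars_in_sum: "(\<And>a. a \<in> A \<Longrightarrow> vars_in S (f a)) \<Longrightarrow> vars_in S (\<Sum>a\<in>A. f a)"
  by (induction A rule: infinite_finite_induct) (simp_all add: vars_in_0 vars_in_add)

lemma vars_in_prod: "(\<And>a. a \<in> A \<Longrightarrow> vars_in S (f a)) \<Longrightarrow> vars_in S (\<Prod>a\<in>A. f a)"
  by (induction A rule: infinite_finite_induct) (simp_all add: vars_in_1 vars_in_mult)

lemma vars_in_power: "vars_in S f \<Longrightarrow> vars_in S (f ^ n)"
  by (induction n) (simp_all add: vars_in_1 vars_in_mult)

lemma vars_in_of_int: "vars_in S (of_int n)"
  by (induction n rule: int_induct[where k = 0])
    (simp_all add: vars_in_0 vars_in_1 vars_in_add vars_in_minus)

lemma vars_in_det: "(\<And>a b. vars_in S (M $ a $ b)) \<Longrightarrow> vars_in S (det M)"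
  unfolding det_def by (intro vars_in_sum vars_in_mult vars_in_of_int vars_in_prod) auto

text \<open>A generalized Vandermonde matrix: rows are points, columns are monomials centred at the
  point \<open>i0\<close>, and the coordinates of the points are themselves indeterminates.\<close>

definition alternant :: "('n::finite \<Rightarrow> nat \<times> nat) \<Rightarrow> nat \<Rightarrow> ('n \<Rightarrow> nat) \<Rightarrow> mpoly ^ 'n ^ 'n" where
  "alternant e i0 r = (\<chi> a b. (Var (2 * r a) - Var (2 * i0)) ^ fst (e b)
      * (Var (2 * r a + 1) - Var (2 * i0 + 1)) ^ snd (e b))"

lemma meval_det_alternant:
  "meval (det (alternant e i0 r)) x = det (\<chi> a b. (x (2 * r a) - x (2 * i0)) ^ fst (e b)
      * (x (2 * r a + 1) - x (2 * i0 + 1)) ^ snd (e b))"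
  unfolding meval_eq_ev alternant_def
  by (simp add: meval.ev_det meval.ev_mult meval.ev_power meval.ev_minus meval.ev_Var)

text \<open>Point \<open>i\<close> has the coordinates \<open>2 * i\<close> and
  \<open>2 * i + 1\<close>, so the points 1 to 8 occupy exactly the variables 2 to 17.\<close>

lemma vars_in_alternant:
  assumes "i0 \<in> {1..8}" "range r \<subseteq> {1..8}"
  shows "vars_in {2..17} (det (alternant e i0 r))"
proof (rule vars_in_det)
  fix a b
  have "r a \<in> {1..8}" using assms(2) by blast
  then show "vars_in {2..17} (alternant e i0 r $ a $ b)"
    using assms(1) unfolding alternant_def
    by (auto intro!: vars_in_mult vars_in_power vars_in_minus vars_in_Var)
qed

text \<open>On the curve \<open>(s, s^4)\<close> the monomials in question become distinct powers of \<open>s\<close>.\<close>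
lemma det_alternant_nonzero:
  fixes e :: "'n::finite \<Rightarrow> nat \<times> nat"
  assumes e: "inj e" "\<And>b. fst (e b) < 4" and r: "inj r" "i0 \<notin> range r"
  shows "det (alternant e i0 r) \<noteq> 0"
proof -
  \<comment> \<open>Since the first exponent is below 4, \<open>?d\<close> encodes the exponent pair
    in base 4 without loss.\<close>
  let ?d = "\<lambda>b. fst (e b) + 4 * snd (e b)"
  have inj: "inj ?d"
  proof (rule injI)
    fix b b' assume eq: "?d b = ?d b'"
    have "?d b mod 4 = fst (e b)" "?d b div 4 = snd (e b)"
      "?d b' mod 4 = fst (e b')" "?d b' div 4 = snd (e b')" using e(2) by simp_all
    then have "e b = e b'" using eq by (metis prod.expand)
    then show "b = b'" using e(1) by (simp add: inj_eq)
  qed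
  have "\<exists>s. det (\<chi> a b. (s a ^ ?d b :: complex)) \<noteq> 0"
  proof (rule exists_nonsingular_evaluation)
    fix c :: "'n \<Rightarrow> complex" and b
    assume c: "\<And>s. (\<Sum>b\<in>UNIV. c b * s ^ ?d b) = 0"
    define p where "p = (\<Sum>b\<in>UNIV. monom (c b) (?d b))"
    have "poly p s = 0" for s using c[of s] by (simp add: p_def poly_sum poly_monom)
    then have "p = 0" by (metis poly_all_0_iff_0)
    then have "0 = coeff p (?d b)" by simp
    also have "\<dots> = (\<Sum>b'\<in>UNIV. if b' = b then c b' else 0)"
      unfolding p_def coeff_sum by (rule sum.cong) (auto dest: injD[OF inj])
    finally show "c b = 0" by simp
  qed
  then obtain s where s: "det (\<chi> a b. (s a ^ ?d b :: complex)) \<noteq> 0" by blast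
  \<comment> \<open>The centre \<open>i0\<close> lies outside the range of \<open>r\<close> and goes
    to the origin by the default value 0; the point \<open>r a\<close> goes to
    \<open>(s a, s a ^ 4)\<close>.\<close>
  define x where "x i = (if i div 2 \<in> range r then s (inv r (i div 2)) ^ (if even i then 1 else 4) else 0)" for i
  have "x (2 * r a) = s a" "x (2 * r a + 1) = s a ^ 4" "x (2 * i0) = 0" "x (2 * i0 + 1) = 0" for a
    using r by (simp_all add: x_def)
  then have "meval (det (alternant e i0 r)) x = det (\<chi> a b. s a ^ ?d b)"
    by (simp add: meval_det_alternant power_add power_mult)
  with s show ?thesis by (auto simp: meval_def)
qed

text \<open>Only finitely many centres and injective selections of points occur, so one product of
  nonzero determinants excludes all degenerate cases at once.\<close>

lemma generic_alternant:
  fixes e :: "'n::finite \<Rightarrow> nat \<times> nat"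
  assumes e: "inj e" "\<And>b. fst (e b) < 4"
  shows "\<exists>g. g \<noteq> 0 \<and> vars_in {2..17} g \<and> (\<forall>x. meval g x \<noteq> 0 \<longrightarrow>
    (\<forall>i0\<in>{1..8}. \<forall>r::'n \<Rightarrow> nat. inj r \<longrightarrow> range r \<subseteq> {1..8} - {i0} \<longrightarrow>
      meval (det (alternant e i0 r)) x \<noteq> 0))"
proof -
  let ?R = "\<lambda>i0. {r :: 'n \<Rightarrow> nat. inj r \<and> range r \<subseteq> {1..8} - {i0}}"
  have fin: "finite (?R i0)" for i0
  proof (rule finite_subset)
    show "?R i0 \<subseteq> UNIV \<rightarrow>\<^sub>E {1..8}" by (auto simp: PiE_def)
  qed (simp add: finite_PiE)
  define g where "g = (\<Prod>i0\<in>{1..8}. \<Prod>r\<in>?R i0. det (alternant e i0 r))"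
  have "g \<noteq> 0"
  proof -
    have "det (alternant e i0 r) \<noteq> 0" if "r \<in> ?R i0" for i0 r
      using that by (intro det_alternant_nonzero e) auto
    then show ?thesis unfolding g_def using fin by (simp add: prod_zero_iff)
  qed
  moreover have "vars_in {2..17} g"
    unfolding g_def by (intro vars_in_prod vars_in_alternant) auto
  moreover have "meval (det (alternant e i0 r)) x \<noteq> 0"
    if "meval g x \<noteq> 0" "i0 \<in> {1..8}" "inj r" "range r \<subseteq> {1..8} - {i0}" for x i0 r
    using that fin unfolding g_def meval_eq_ev
    by (auto simp: meval.ev_prod prod_zero_iff)
  ultimately show ?thesis by blast
qed

lemma det_nonzero_ker:
  fixes A :: "complex ^ 'n ^ 'n"
  assumes "det A \<noteq> 0" "A *v c = 0"
  shows "c = 0"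
  using assms invertible_det_nz invertible_left_inverse matrix_left_invertible_ker by blast

text \<open>The term is from interpolation: a combination of the monomials \<open>J\<close>, centred
  at the point \<open>i0\<close>, is zero once it vanishes at \<open>card J\<close> of the other
  points. \<open>K\<close> omits the centre, where monomials of positive degree give no
  condition.\<close>

definition unisolvent :: "(nat \<times> nat) set \<Rightarrow> (nat \<Rightarrow> complex) \<Rightarrow> bool" where
  "unisolvent J x \<longleftrightarrow>
    (\<forall>i0\<in>{1..8}. \<forall>K\<subseteq>{1..8} - {i0}. card J \<le> card K \<longrightarrow> (\<forall>c :: nat \<times> nat \<Rightarrow> complex.
      (\<forall>j\<in>K. (\<Sum>m\<in>J. c m * (x (2 * j) - x (2 * i0)) ^ fst m * (x (2 * j + 1) - x (2 * i0 + 1)) ^ snd m) = 0)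
      \<longrightarrow> (\<forall>m\<in>J. c m = 0)))"

text \<open>The type \<open>'n\<close> merely supplies \<open>card J\<close> indices for rows and
  columns. A vanishing combination is a kernel vector of a nonsingular alternant.\<close>

lemma generic_unisolvent:
  fixes J :: "(nat \<times> nat) set"
  assumes J: "card J = CARD('n::finite)" "\<And>a b. (a, b) \<in> J \<Longrightarrow> a < 4"
  shows "\<exists>g. g \<noteq> 0 \<and> vars_in {2..17} g \<and> (\<forall>x. meval g x \<noteq> 0 \<longrightarrow> unisolvent J x)"
proof -
  have finJ: "finite J" using J(1) by (metis card.infinite zero_less_card_finite less_irrefl)
  obtain e :: "'n \<Rightarrow> nat \<times> nat" where e: "bij_betw e UNIV J"
    using finite_same_card_bij[of "UNIV :: 'n set" J] finJ J(1) by auto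
  then have inj: "inj e" and ran: "range e = J" by (auto simp: bij_betw_def)
  have lt: "fst (e b) < 4" for b using J(2) ran by (metis prod.collapse rangeI)
  obtain g where g: "g \<noteq> 0" "vars_in {2..17} g" and gen: "\<And>x i0 r. meval g x \<noteq> 0 \<Longrightarrow> i0 \<in> {1..8} \<Longrightarrow>
      inj r \<Longrightarrow> range r \<subseteq> {1..8} - {i0} \<Longrightarrow> meval (det (alternant e i0 r)) x \<noteq> 0"
    using generic_alternant[of e, OF inj lt] by blast
  have "\<forall>m\<in>J. c m = 0"
    if x: "meval g x \<noteq> 0" and i0: "i0 \<in> {1..8}" and K: "K \<subseteq> {1..8} - {i0}" "card J \<le> card K"
      and c: "\<And>j. j \<in> K \<Longrightarrow> (\<Sum>m\<in>J. c m * (x (2 * j) - x (2 * i0)) ^ fst m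
        * (x (2 * j + 1) - x (2 * i0 + 1)) ^ snd m) = 0"
    for x i0 K and c :: "nat \<times> nat \<Rightarrow> complex"
  proof -
    have finK: "finite K" using K(1) finite_subset by blast
    obtain r :: "'n \<Rightarrow> nat" where r: "range r \<subseteq> K" "inj r"
      using card_le_inj[of "UNIV :: 'n set" K] finK K(2) J(1) by auto
    let ?A = "\<chi> a b. (x (2 * r a) - x (2 * i0)) ^ fst (e b) * (x (2 * r a + 1) - x (2 * i0 + 1)) ^ snd (e b)"
    have "det ?A \<noteq> 0"
      using gen[OF x i0 r(2)] r(1) K(1) by (auto simp: meval_det_alternant)
    moreover have "?A *v (\<chi> b. c (e b)) = 0"
    proof -
      have "(?A *v (\<chi> b. c (e b))) $ a = 0" for a
      proof -
        have "(?A *v (\<chi> b. c (e b))) $ a = (\<Sum>m\<in>J. c m * (x (2 * r a) - x (2 * i0)) ^ fst m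
            * (x (2 * r a + 1) - x (2 * i0 + 1)) ^ snd m)"
          unfolding sum.reindex_bij_betw[OF e, symmetric]
          by (simp add: matrix_vector_mult_def mult_ac)
        also have "\<dots> = 0" using c r(1) by blast
        finally show ?thesis .
      qed
      then show ?thesis by (simp add: vec_eq_iff)
    qed
    ultimately have "(\<chi> b. c (e b)) = 0" by (rule det_nonzero_ker)
    then have "c (e b) = 0" for b by (metis vec_lambda_beta zero_index)
    then show ?thesis using ran by blast
  qed
  then show ?thesis using g unfolding unisolvent_def by blast
qed

subsection \<open>Forms of degree at most three\<close>

text \<open>Gaussian elimination, one equation at a time: a pivot \<open>i0\<close> of equation
  \<open>k\<close> is eliminated from the others, and a solution on the smaller index set is
  extended by the value \<open>t\<close> that equation \<open>k\<close> prescribes.\<close>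

lemma underdetermined_system:
  fixes a :: "'k \<Rightarrow> 'i \<Rightarrow> 'f::field"
  assumes "finite K" "finite I" "card K < card I"
  shows "\<exists>c. (\<exists>i\<in>I. c i \<noteq> 0) \<and> (\<forall>k\<in>K. (\<Sum>i\<in>I. c i * a k i) = 0)"
  using assms
proof (induction K arbitrary: I a rule: finite_induct)
  case empty
  then show ?case by (intro exI[of _ "\<lambda>_. 1"]) (auto simp: card_gt_0_iff)
next
  case (insert k K)
  show ?case
  proof (cases "\<forall>i\<in>I. a k i = 0")
    case True
    have "card K < card I" using insert by simp
    from insert.IH[OF insert.prems(1) this] True show ?thesis by fastforce
  next
    case False
    then obtain i0 where i0: "i0 \<in> I" "a k i0 \<noteq> 0" by blast
    let ?I = "I - {i0}"
    define a' where "a' k' i = a k' i - a k' i0 * (a k i / a k i0)" for k' i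
    have "card K < card ?I" using insert.hyps insert.prems i0(1) by simp
    then obtain c where c: "\<exists>i\<in>?I. c i \<noteq> 0" "\<forall>k\<in>K. (\<Sum>i\<in>?I. c i * a' k i) = 0"
      using insert.IH[of ?I a'] insert.prems(1) by auto
    define t where "t = - (\<Sum>i\<in>?I. c i * a k i) / a k i0"
    define c' where "c' = c(i0 := t)"
    have sum: "(\<Sum>i\<in>I. c' i * a k' i) = t * a k' i0 + (\<Sum>i\<in>?I. c i * a k' i)" for k'
      by (simp add: sum.remove[OF insert.prems(1) i0(1)] c'_def)
    have "(\<Sum>i\<in>I. c' i * a k i) = 0"
      unfolding sum t_def using i0(2) by simp
    moreover have "(\<Sum>i\<in>I. c' i * a k' i) = 0" if "k' \<in> K" for k'
    proof -
      have "(\<Sum>i\<in>?I. c i * a' k' i) = (\<Sum>i\<in>?I. c i * a k' i) - (\<Sum>i\<in>?I. c i * a k i) * (a k' i0 / a k i0)"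
        unfolding a'_def by (simp add: sum_subtractf sum_distrib_left sum_divide_distrib algebra_simps)
      then show ?thesis using c(2) that unfolding sum t_def by (simp add: algebra_simps)
    qed
    moreover have "\<exists>i\<in>I. c' i \<noteq> 0" using c(1) by (auto simp: c'_def)
    ultimately show ?thesis by blast
  qed
qed

section \<open>Homogeneous coordinates and forms\<close>

lemma cc_vadd [simp]: "cc (vadd u v) i = cc u i + cc v i"
  and cc_vscale [simp]: "cc (vscale s v) i = s * cc v i"
  by (auto simp: cc_def vadd_def vscale_def split: prod.splits)

lemma cc_triple [simp]: "cc (a, b, c) i = (if i = 0 then a else if i = 1 then b else c)"
  by (simp add: cc_def)

lemma cvec_eq_iff: "u = v \<longleftrightarrow> cc u 0 = cc v 0 \<and> cc u 1 = cc v 1 \<and> cc u 2 = cc v 2"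
  by (cases u; cases v) simp

lemma vscale_1 [simp]: "vscale 1 v = v"
  by (simp add: cvec_eq_iff)

lemma peval_eq_ev: "peval F v = ev (\<lambda>c. c) (cc v) F"
  by (simp add: peval_def meval_eq_ev)

lemma peval_mult: "peval (F * G) v = peval F v * peval G v"
  by (simp add: peval_eq_ev meval.ev_mult)

lemma homogD:
  assumes "homog n F" "m \<in> Poly_Mapping.keys F"
  shows "Poly_Mapping.keys m \<subseteq> {0, 1, 2}" "wt m = n"
    "Poly_Mapping.lookup m 0 + Poly_Mapping.lookup m 1 + Poly_Mapping.lookup m 2 = n"
proof -
  show *: "Poly_Mapping.keys m \<subseteq> {0, 1, 2}" using assms unfolding homog_def by blast
  have "(\<Sum>i\<in>{0, 1, 2 :: nat}. Poly_Mapping.lookup m i) = n"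
    using assms unfolding homog_def by blast
  then show "wt m = n" "Poly_Mapping.lookup m 0 + Poly_Mapping.lookup m 1 + Poly_Mapping.lookup m 2 = n"
    by (simp_all add: wt_superset[OF _ *])
qed

lemma homog_iff_wt: "homog n F \<longleftrightarrow> (\<forall>m\<in>Poly_Mapping.keys F. Poly_Mapping.keys m \<subseteq> {0, 1, 2} \<and> wt m = n)"
  unfolding homog_def by (intro ball_cong refl conj_cong) (simp add: wt_superset[of "{0, 1, 2}"])

lemma homog_mult:
  assumes "homog n F" "homog k G"
  shows "homog (n + k) (F * G)"
  unfolding homog_iff_wt
proof
  fix m assume "m \<in> Poly_Mapping.keys (F * G)"
  then obtain a b where m: "m = a + b" "a \<in> Poly_Mapping.keys F" "b \<in> Poly_Mapping.keys G"
    using keys_mult[of F G] by blast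
  note a = homogD[OF assms(1) m(2)] and b = homogD[OF assms(2) m(3)]
  have "Poly_Mapping.keys m \<subseteq> {0, 1, 2}"
    using Poly_Mapping.keys_add[of a b] a(1) b(1) unfolding m(1) by blast
  then show "Poly_Mapping.keys m \<subseteq> {0, 1, 2} \<and> wt m = n + k"
    by (simp only: m(1) wt_add a(2) b(2) simp_thms)
qed

lemma peval_vscale:
  assumes "homog n F"
  shows "peval F (vscale c v) = c ^ n * peval F v"
proof -
  have "cc (vscale c v) = (\<lambda>i. c * cc v i)" by (rule ext) simp
  then show ?thesis
    by (simp add: peval_eq_ev ev_def mon_scale sum_distrib_left homogD[OF assms] mult_ac)
qed

text \<open>Kronecker substitution: on the curve \<open>(s, s ^ Suc n, 1)\<close> the first two
  exponents, each at most \<open>n\<close>, become the digits of one exponent in base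
  \<open>n + 1\<close>, and homogeneity forces the third. A form with only zero values would thus
  have only zero coefficients.\<close>

lemma exists_peval_nonzero:
  assumes "homog n F" "F \<noteq> 0"
  shows "\<exists>v. peval F v \<noteq> 0"
proof (rule ccontr)
  assume "\<not> ?thesis"
  then have z: "peval F v = 0" for v by blast
  let ?K = "Poly_Mapping.keys F"
  let ?e = "\<lambda>m. Poly_Mapping.lookup m 0 + Suc n * Poly_Mapping.lookup m 1"
  define q where "q = (\<Sum>m\<in>?K. monom (Poly_Mapping.lookup F m) (?e m))"
  have "poly q s = peval F (s, s ^ Suc n, 1)" for s
  proof -
    have "mon (cc (s, s ^ Suc n, 1)) m = s ^ ?e m" if "m \<in> ?K" for m
      by (simp add: mon_superset[OF _ homogD(1)[OF assms(1) that]] power_add power_mult del: power_Suc mult_Suc)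
    then show ?thesis
      by (simp add: q_def poly_sum poly_monom peval_eq_ev ev_def del: power_Suc mult_Suc)
  qed
  with z have "q = 0" by (metis poly_all_0_iff_0)
  have inj: "inj_on ?e ?K"
  proof (rule inj_onI)
    fix m m' assume m: "m \<in> ?K" "m' \<in> ?K" and eq: "?e m = ?e m'"
    note h = homogD[OF assms(1) m(1)] homogD[OF assms(1) m(2)]
    have "?e m mod Suc n = Poly_Mapping.lookup m 0" "?e m div Suc n = Poly_Mapping.lookup m 1"
      "?e m' mod Suc n = Poly_Mapping.lookup m' 0" "?e m' div Suc n = Poly_Mapping.lookup m' 1"
      using h by (simp_all del: mult_Suc)
    then have "Poly_Mapping.lookup m 0 = Poly_Mapping.lookup m' 0"
      "Poly_Mapping.lookup m 1 = Poly_Mapping.lookup m' 1" using eq by metis+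
    moreover then have "Poly_Mapping.lookup m 2 = Poly_Mapping.lookup m' 2" using h by linarith
    moreover have "Poly_Mapping.lookup m i = Poly_Mapping.lookup m' i" if "i \<notin> {0, 1, 2}" for i
      using h(1,4) that by (metis in_keys_iff subsetD)
    ultimately show "m = m'" by (intro poly_mapping_eqI) (metis insertCI insertE empty_iff)
  qed
  from \<open>F \<noteq> 0\<close> obtain m where m: "m \<in> ?K" using keys_eq_empty by blast
  have "0 = coeff q (?e m)" using \<open>q = 0\<close> by simp
  also have "\<dots> = (\<Sum>m'\<in>?K. if m' = m then Poly_Mapping.lookup F m' else 0)"
    unfolding q_def coeff_sum using m inj by (intro sum.cong) (auto dest: inj_onD)
  also have "\<dots> = Poly_Mapping.lookup F m" using m by simp
  finally show False using m by (simp add: in_keys_iff)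
qed

lemma cramer:
  fixes p A B v :: cvec
  defines "d \<equiv> det3 p A B"
  assumes "d \<noteq> 0"
  shows "v = vadd (vscale (det3 v A B / d) p) (vadd (vscale (det3 p v B / d) A) (vscale (det3 p A v / d) B))"
proof -
  have "d * cc v i = det3 v A B * cc p i + det3 p v B * cc A i + det3 p A v * cc B i"
    if "i = 0 \<or> i = 1 \<or> i = 2" for i
    using that unfolding d_def det3_def by (auto simp: algebra_simps)
  then have "cc v i = (det3 v A B * cc p i + det3 p v B * cc A i + det3 p A v * cc B i) / d"
    if "i = 0 \<or> i = 1 \<or> i = 2" for i
    using assms(2) that by (metis nonzero_mult_div_cancel_left)
  then show ?thesis by (simp add: cvec_eq_iff add_divide_distrib)
qed

lemma poly_ev_line:
  "poly (ev (\<lambda>c. [:c:]) (\<lambda>i. [:cc u i, cc w i:]) F) s = peval F (vadd u (vscale s w))"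
proof -
  have "poly (ev (\<lambda>c. [:c:]) (\<lambda>i. [:cc u i, cc w i:]) F) s
      = ev (\<lambda>c. poly [:c:] s) (\<lambda>i. poly [:cc u i, cc w i:] s) F"
    by (rule hom_ev) simp_all
  moreover have "cc (vadd u (vscale s w)) = (\<lambda>i. poly [:cc u i, cc w i:] s)" by (rule ext) simp
  ultimately show ?thesis by (simp add: peval_eq_ev)
qed

text \<open>A point \<open>v\<close> with nonzero value may have \<open>z0 = 0\<close> and lie
  outside the chart. Moving it along \<open>vadd p A\<close> shifts the coordinates of
  \<open>p\<close> and \<open>A\<close> together, and all but finitely many shifts keep the value
  and both coordinates nonzero. The condition \<open>x \<noteq> 0\<close> permits the later
  substitution \<open>y = x * t\<close>.\<close>

lemma exists_chart_nonzero:
  assumes F: "homog n F" "F \<noteq> 0" and d: "det3 p A B \<noteq> 0"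
  shows "\<exists>x y. x \<noteq> 0 \<and> peval F (vadd p (vadd (vscale x A) (vscale y B))) \<noteq> 0"
proof -
  obtain v where v: "peval F v \<noteq> 0" using exists_peval_nonzero[OF F] by blast
  obtain z0 x0 y0 where v_eq: "v = vadd (vscale z0 p) (vadd (vscale x0 A) (vscale y0 B))"
    using cramer[OF d] by blast
  define q where "q = ev (\<lambda>c. [:c:]) (\<lambda>i. [:cc v i, cc (vadd p A) i:]) F"
  have "poly q 0 \<noteq> 0" 
  proof -
    have "vadd v (vscale 0 (vadd p A)) = v" by (simp add: cvec_eq_iff)
    then show ?thesis using v unfolding q_def poly_ev_line by simp
  qed
  then have "q \<noteq> 0" by auto
  then have "q * [:z0, 1:] * [:x0, 1:] \<noteq> 0" by (simp only: mult_eq_0_iff pCons_eq_0_iff) simp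
  then obtain s where "poly (q * [:z0, 1:] * [:x0, 1:]) s \<noteq> 0" by (metis poly_all_0_iff_0)
  then have s: "poly q s \<noteq> 0" "z0 + s \<noteq> 0" "x0 + s \<noteq> 0"
    unfolding poly_mult mult_eq_0_iff by simp_all
  define z x where "z = z0 + s" and "x = x0 + s"
  have z: "z \<noteq> 0" "x \<noteq> 0" using s by (auto simp: z_def x_def)
  have "vadd v (vscale s (vadd p A)) = vscale z (vadd p (vadd (vscale (x / z) A) (vscale (y0 / z) B)))"
  proof -
    have "z * (a + (x / z * b + y0 / z * c)) = z * a + x * b + y0 * c" for a b c
      using z(1) by (simp add: distrib_left)
    then show ?thesis
      by (simp only: cvec_eq_iff v_eq cc_vadd cc_vscale) (simp add: z_def x_def algebra_simps)
  qed
  then have "peval F (vscale z (vadd p (vadd (vscale (x / z) A) (vscale (y0 / z) B)))) \<noteq> 0"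
    using s(1) unfolding q_def poly_ev_line by metis
  then have "peval F (vadd p (vadd (vscale (x / z) A) (vscale (y0 / z) B))) \<noteq> 0"
    unfolding peval_vscale[OF F(1)] by auto
  moreover have "x / z \<noteq> 0" using z by simp
  ultimately show ?thesis by blast
qed

section \<open>Lines and conics as functions of the coordinates\<close>

definition linear_form :: "(cvec \<Rightarrow> complex) \<Rightarrow> bool" where
  "linear_form f \<longleftrightarrow> (\<exists>l. \<forall>v. f v = dot3 l v)"

definition quadratic_form :: "(cvec \<Rightarrow> complex) \<Rightarrow> bool" where
  "quadratic_form f \<longleftrightarrow> (\<exists>a b c d e g. \<forall>v. f v = a * cc v 0 ^ 2 + b * (cc v 0 * cc v 1) + c * cc v 1 ^ 2
     + d * (cc v 0 * cc v 2) + e * (cc v 1 * cc v 2) + g * cc v 2 ^ 2)"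

text \<open>Every index from 2 on reads the third coordinate, so all \<open>i\<close> are covered.
  Hence the factors of a cubic need not be shown to involve only the variables 0, 1, 2.\<close>

lemma linear_form_cc: "linear_form (\<lambda>v. cc v i)"
proof -
  consider "i = 0" | "i = 1" | "i \<noteq> 0" "i \<noteq> 1" by blast
  then show ?thesis
  proof cases
    case 1 then show ?thesis unfolding linear_form_def dot3_def by (intro exI[of _ "(1, 0, 0)"]) simp
  next
    case 2 then show ?thesis unfolding linear_form_def dot3_def by (intro exI[of _ "(0, 1, 0)"]) simp
  next
    case 3 then show ?thesis unfolding linear_form_def dot3_def
      by (intro exI[of _ "(0, 0, 1)"]) (simp add: cc_def split: prod.splits)
  qed
qed

lemma linear_form_0: "linear_form (\<lambda>v. 0)"
  unfolding linear_form_def dot3_def by (intro exI[of _ "(0, 0, 0)"]) simp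

lemma linear_form_add: "linear_form f \<Longrightarrow> linear_form g \<Longrightarrow> linear_form (\<lambda>v. f v + g v)"
  unfolding linear_form_def
proof (elim exE)
  fix l k assume "\<forall>v. f v = dot3 l v" "\<forall>v. g v = dot3 k v"
  then show "\<exists>l. \<forall>v. f v + g v = dot3 l v"
    by (intro exI[of _ "vadd l k"]) (simp add: dot3_def algebra_simps)
qed

lemma linear_form_cmult: "linear_form f \<Longrightarrow> linear_form (\<lambda>v. c * f v)"
  unfolding linear_form_def
proof (elim exE)
  fix l assume "\<forall>v. f v = dot3 l v"
  then show "\<exists>l. \<forall>v. c * f v = dot3 l v"
    by (intro exI[of _ "vscale c l"]) (simp add: dot3_def algebra_simps)
qed

lemma linear_form_sum: "(\<And>a. a \<in> S \<Longrightarrow> linear_form (f a)) \<Longrightarrow> linear_form (\<lambda>v. \<Sum>a\<in>S. f a v)"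
  by (induction S rule: infinite_finite_induct) (simp_all add: linear_form_0 linear_form_add)

lemma quadratic_form_mult:
  assumes "linear_form f" "linear_form g"
  shows "quadratic_form (\<lambda>v. f v * g v)"
proof -
  obtain l k where l: "\<And>v. f v = dot3 l v" "\<And>v. g v = dot3 k v"
    using assms unfolding linear_form_def by blast
  have "f v * g v = cc l 0 * cc k 0 * cc v 0 ^ 2 + (cc l 0 * cc k 1 + cc l 1 * cc k 0) * (cc v 0 * cc v 1)
     + cc l 1 * cc k 1 * cc v 1 ^ 2 + (cc l 0 * cc k 2 + cc l 2 * cc k 0) * (cc v 0 * cc v 2)
     + (cc l 1 * cc k 2 + cc l 2 * cc k 1) * (cc v 1 * cc v 2) + cc l 2 * cc k 2 * cc v 2 ^ 2" for v
    unfolding l dot3_def by (simp add: algebra_simps power2_eq_square)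
  then show ?thesis unfolding quadratic_form_def by blast
qed

lemma quadratic_form_0: "quadratic_form (\<lambda>v. 0)"
  unfolding quadratic_form_def by (rule exI[of _ 0])+ simp

lemma quadratic_form_add:
  assumes "quadratic_form f" "quadratic_form g"
  shows "quadratic_form (\<lambda>v. f v + g v)"
  using assms unfolding quadratic_form_def
proof (elim exE)
  fix a b c d e h a' b' c' d' e' h'
  assume f: "\<forall>v. f v = a * cc v 0 ^ 2 + b * (cc v 0 * cc v 1) + c * cc v 1 ^ 2
     + d * (cc v 0 * cc v 2) + e * (cc v 1 * cc v 2) + h * cc v 2 ^ 2"
    and g: "\<forall>v. g v = a' * cc v 0 ^ 2 + b' * (cc v 0 * cc v 1) + c' * cc v 1 ^ 2
     + d' * (cc v 0 * cc v 2) + e' * (cc v 1 * cc v 2) + h' * cc v 2 ^ 2"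
  have "f v + g v = (a + a') * cc v 0 ^ 2 + (b + b') * (cc v 0 * cc v 1) + (c + c') * cc v 1 ^ 2
     + (d + d') * (cc v 0 * cc v 2) + (e + e') * (cc v 1 * cc v 2) + (h + h') * cc v 2 ^ 2" for v
    by (simp add: f g distrib_right)
  then show "\<exists>a b c d e h. \<forall>v. f v + g v = a * cc v 0 ^ 2 + b * (cc v 0 * cc v 1) + c * cc v 1 ^ 2
     + d * (cc v 0 * cc v 2) + e * (cc v 1 * cc v 2) + h * cc v 2 ^ 2" by blast
qed

lemma quadratic_form_cmult:
  assumes "quadratic_form f"
  shows "quadratic_form (\<lambda>v. k * f v)"
  using assms unfolding quadratic_form_def
proof (elim exE)
  fix a b c d e h
  assume f: "\<forall>v. f v = a * cc v 0 ^ 2 + b * (cc v 0 * cc v 1) + c * cc v 1 ^ 2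
     + d * (cc v 0 * cc v 2) + e * (cc v 1 * cc v 2) + h * cc v 2 ^ 2"
  have "k * f v = (k * a) * cc v 0 ^ 2 + (k * b) * (cc v 0 * cc v 1) + (k * c) * cc v 1 ^ 2
     + (k * d) * (cc v 0 * cc v 2) + (k * e) * (cc v 1 * cc v 2) + (k * h) * cc v 2 ^ 2" for v
    by (simp only: f[rule_format] distrib_left ac_simps)
  then show "\<exists>a b c d e h. \<forall>v. k * f v = a * cc v 0 ^ 2 + b * (cc v 0 * cc v 1) + c * cc v 1 ^ 2
     + d * (cc v 0 * cc v 2) + e * (cc v 1 * cc v 2) + h * cc v 2 ^ 2" by blast
qed

lemma quadratic_form_sum:
  "(\<And>a. a \<in> S \<Longrightarrow> quadratic_form (f a)) \<Longrightarrow> quadratic_form (\<lambda>v. \<Sum>a\<in>S. f a v)"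
  by (induction S rule: infinite_finite_induct) (simp_all add: quadratic_form_0 quadratic_form_add)

lemma mon_wt_1:
  assumes "wt m = 1"
  shows "\<exists>i. \<forall>X :: nat \<Rightarrow> complex. mon X m = X i"
proof -
  obtain i m' where m: "m = Poly_Mapping.single i 1 + m'" "wt m' = 0"
    using wt_Suc_decompose[of m 0] assms by auto
  then have "mon X m = X i" for X :: "nat \<Rightarrow> complex" by (simp add: mon_add wt_eq_0_iff)
  then show ?thesis by blast
qed

lemma mon_wt_2:
  assumes "wt m = 2"
  shows "\<exists>i j. \<forall>X :: nat \<Rightarrow> complex. mon X m = X i * X j"
proof -
  obtain i m' where m: "m = Poly_Mapping.single i 1 + m'" "wt m' = 1"
    using wt_Suc_decompose[of m 1] assms by (auto simp: numeral_2_eq_2)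
  obtain j where "\<forall>X :: nat \<Rightarrow> complex. mon X m' = X j" using mon_wt_1[OF m(2)] by blast
  then have "mon X m = X i * X j" for X :: "nat \<Rightarrow> complex" by (simp add: m(1) mon_add)
  then show ?thesis by blast
qed

lemma mon_wt_3:
  assumes "wt m = 3"
  shows "\<exists>i j k. \<forall>X :: nat \<Rightarrow> complex. mon X m = X i * X j * X k"
proof -
  obtain i m' where m: "m = Poly_Mapping.single i 1 + m'" "wt m' = 2"
    using wt_Suc_decompose[of m 2] assms by (auto simp: numeral_eq_Suc)
  obtain j k where "\<forall>X :: nat \<Rightarrow> complex. mon X m' = X j * X k" using mon_wt_2[OF m(2)] by blast
  then have "mon X m = X i * X j * X k" for X :: "nat \<Rightarrow> complex" by (simp add: m(1) mon_add mult.assoc)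
  then show ?thesis by blast
qed

lemma linear_form_peval:
  assumes "\<And>m. m \<in> Poly_Mapping.keys F \<Longrightarrow> wt m = 1"
  shows "linear_form (peval F)"
proof -
  have "linear_form (\<lambda>v. mon (cc v) m)" if m: "m \<in> Poly_Mapping.keys F" for m
  proof -
    obtain i where "\<And>X :: nat \<Rightarrow> complex. mon X m = X i" using mon_wt_1[OF assms[OF m]] by blast
    then show ?thesis by (simp add: linear_form_cc)
  qed
  then have "linear_form (\<lambda>v. ev (\<lambda>c. c) (cc v) F)"
    unfolding ev_def by (rule linear_form_sum[OF linear_form_cmult])
  then show ?thesis by (simp add: peval_eq_ev[abs_def])
qed

lemma quadratic_form_peval:
  assumes "\<And>m. m \<in> Poly_Mapping.keys F \<Longrightarrow> wt m = 2"
  shows "quadratic_form (peval F)"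
proof -
  have "quadratic_form (\<lambda>v. mon (cc v) m)" if m: "m \<in> Poly_Mapping.keys F" for m
  proof -
    obtain i j where "\<And>X :: nat \<Rightarrow> complex. mon X m = X i * X j" using mon_wt_2[OF assms[OF m]] by blast
    then show ?thesis by (simp add: quadratic_form_mult linear_form_cc)
  qed
  then have "quadratic_form (\<lambda>v. ev (\<lambda>c. c) (cc v) F)"
    unfolding ev_def by (rule quadratic_form_sum[OF quadratic_form_cmult])
  then show ?thesis by (simp add: peval_eq_ev[abs_def])
qed

text \<open>Here \<open>D p w\<close> is the derivative of the cubic at \<open>p\<close> in direction \<open>w\<close>.\<close>
definition cubic_expansion ::
  "mpoly \<Rightarrow> (cvec \<Rightarrow> cvec \<Rightarrow> complex) \<Rightarrow> (cvec \<Rightarrow> cvec \<Rightarrow> cvec \<Rightarrow> complex) \<Rightarrow> bool" where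
  "cubic_expansion F D S \<longleftrightarrow>
     (\<forall>p u w. D p (vadd u w) = D p u + D p w) \<and> (\<forall>p a w. D p (vscale a w) = a * D p w) \<and>
     (\<forall>p. D p p = 3 * peval F p) \<and>
     (\<forall>p A B z x y. peval F (vadd (vscale z p) (vadd (vscale x A) (vscale y B))) =
       z^3 * peval F p + z^2 * x * D p A + z^2 * y * D p B
       + z * x^2 * D A p + z * x * y * S p A B + z * y^2 * D B p
       + x^3 * peval F A + x^2 * y * D A B + x * y^2 * D B A + y^3 * peval F B)"

lemma cubic_expansionD:
  assumes "cubic_expansion F D S"
  shows "D p (vadd u w) = D p u + D p w" "D p (vscale a w) = a * D p w" "D p p = 3 * peval F p"
    "peval F (vadd (vscale z p) (vadd (vscale x A) (vscale y B))) =
       z^3 * peval F p + z^2 * x * D p A + z^2 * y * D p B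
       + z * x^2 * D A p + z * x * y * S p A B + z * y^2 * D B p
       + x^3 * peval F A + x^2 * y * D A B + x * y^2 * D B A + y^3 * peval F B"
  using assms unfolding cubic_expansion_def by blast+

text \<open>By Euler's relation \<open>D p p = 3 * peval F p\<close> the derivative in direction
  \<open>p\<close> vanishes too, and \<open>p\<close>, \<open>A\<close>, \<open>B\<close>
  span.\<close>

lemma singular_if_frame:
  assumes "cubic_expansion F D S" "det3 p A B \<noteq> 0" "peval F p = 0" "D p A = 0" "D p B = 0"
  shows "D p w = 0"
proof -
  obtain a b c where "w = vadd (vscale a p) (vadd (vscale b A) (vscale c B))"
    using cramer[OF assms(2)] by blast
  then show ?thesis using assms(3-5) by (simp add: cubic_expansionD(1-3)[OF assms(1)])
qed

text \<open>Writing each monomial as an ordered product of three coordinates gives a trilinear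
  \<open>T\<close> with \<open>F\<close> on its diagonal. \<open>T\<close> need not be symmetric, so
  \<open>D\<close> and \<open>S\<close> sum over all placements of their arguments.\<close>

lemma cubic_expansion_exists:
  assumes "homog 3 F"
  shows "\<exists>D S. cubic_expansion F D S"
proof -
  have "\<forall>m\<in>Poly_Mapping.keys F. \<exists>i j k. \<forall>X :: nat \<Rightarrow> complex. mon X m = X i * X j * X k"
    using mon_wt_3 homogD(2)[OF assms] by blast
  then obtain i j k where ijk:
    "\<And>m X. m \<in> Poly_Mapping.keys F \<Longrightarrow> mon (X :: nat \<Rightarrow> complex) m = X (i m) * X (j m) * X (k m)"
    by metis
  define T where "T u v w = (\<Sum>m\<in>Poly_Mapping.keys F. Poly_Mapping.lookup F m * (cc u (i m) * cc v (j m) * cc w (k m)))"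
    for u v w
  have F: "peval F v = T v v v" for v
    by (simp add: peval_eq_ev ev_def T_def ijk)
  have T: "T (vadd u u') v w = T u v w + T u' v w" "T v (vadd u u') w = T v u w + T v u' w"
    "T v w (vadd u u') = T v w u + T v w u'"
    "T (vscale a u) v w = a * T u v w" "T v (vscale a u) w = a * T v u w" "T v w (vscale a u) = a * T v w u"
    for u u' v w a
    by (simp_all add: T_def algebra_simps sum.distrib sum_distrib_left)
  define D where "D p w = T w p p + T p w p + T p p w" for p w
  define S where "S p A B = T p A B + T p B A + T A p B + T A B p + T B p A + T B A p" for p A B
  have "peval F (vadd (vscale z p) (vadd (vscale x A) (vscale y B))) =
       z^3 * peval F p + z^2 * x * D p A + z^2 * y * D p B
       + z * x^2 * D A p + z * x * y * S p A B + z * y^2 * D B p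
       + x^3 * peval F A + x^2 * y * D A B + x * y^2 * D B A + y^3 * peval F B" for p A B z x y
    unfolding F T D_def S_def by (simp add: algebra_simps power2_eq_square power3_eq_cube)
  then have "cubic_expansion F D S"
    unfolding cubic_expansion_def by (simp add: D_def F T algebra_simps)
  then show ?thesis by blast
qed

section \<open>Cubics that decompose into a line and a conic\<close>

definition splits :: "mpoly \<Rightarrow> bool" where
  "splits F \<longleftrightarrow> (\<exists>f h. linear_form f \<and> quadratic_form h \<and> (\<forall>v. peval F v = f v * h v))"

text \<open>The grading of the polynomial ring by total degree, as a ring homomorphism recording the degree in a new variable.\<close>
definition grade :: "mpoly \<Rightarrow> mpoly poly" where
  "grade = ev (\<lambda>c. [:Poly_Mapping.single 0 c:]) (\<lambda>i. monom 1 1 * [:Var i:])"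

interpretation grade: coeff_hom "\<lambda>c. [:Poly_Mapping.single 0 c:] :: mpoly poly"
  by standard (simp_all add: single_add mult_single mult.commute)

lemma mon_Var: "mon (\<lambda>i. [:Var i:]) m = [:Poly_Mapping.single m 1:]"
proof (induction "wt m" arbitrary: m)
  case 0
  then show ?case by (simp add: wt_eq_0_iff)
next
  case (Suc n)
  then obtain i m' where m: "m = Poly_Mapping.single i 1 + m'" "wt m' = n"
    by (metis wt_Suc_decompose)
  then show ?case
    using Suc.hyps(1)[of m'] by (simp add: mon_add Var_def mult_single add.commute)
qed

lemma lookup_coeff_grade:
  "Poly_Mapping.lookup (coeff (grade F) k) m = (if wt m = k then Poly_Mapping.lookup F m else 0)"
proof -
  have "grade F = (\<Sum>m\<in>Poly_Mapping.keys F. monom (Poly_Mapping.single m (Poly_Mapping.lookup F m)) (wt m))"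
    unfolding grade_def ev_def mon_scale mon_Var
    by (intro sum.cong refl) (simp add: mult_single monom_power smult_monom mult_monom flip: monom_0)
  then have "Poly_Mapping.lookup (coeff (grade F) k) m = (\<Sum>m'\<in>Poly_Mapping.keys F.
      Poly_Mapping.lookup (if wt m' = k then Poly_Mapping.single m' (Poly_Mapping.lookup F m') else 0) m)"
    by (simp add: coeff_sum lookup_sum)
  also have "\<dots> = (\<Sum>m'\<in>Poly_Mapping.keys F. if m' = m then (if wt m = k then Poly_Mapping.lookup F m else 0) else 0)"
    by (rule sum.cong) (auto simp: lookup_single when_def)
  also have "\<dots> = (if wt m = k then Poly_Mapping.lookup F m else 0)"
    by (auto simp: in_keys_iff)
  finally show ?thesis .
qed

lemma grade_homog:
  assumes "homog n F"
  shows "grade F = monom F n"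
proof (rule poly_eqI)
  fix k
  show "coeff (grade F) k = coeff (monom F n) k"
  proof (rule poly_mapping_eqI)
    fix m
    have "Poly_Mapping.lookup F m = 0 \<or> wt m = n"
      using homogD(2)[OF assms, of m] by (auto simp: in_keys_iff)
    then show "Poly_Mapping.lookup (coeff (grade F) k) m = Poly_Mapping.lookup (coeff (monom F n) k) m"
      by (auto simp: lookup_coeff_grade)
  qed
qed

lemma is_unit_if_degree_grade_0:
  assumes "degree (grade F) = 0" "F \<noteq> 0"
  shows "F dvd 1"
proof -
  have "m = 0" if "m \<in> Poly_Mapping.keys F" for m
  proof -
    have "Poly_Mapping.lookup (coeff (grade F) (wt m)) m \<noteq> 0"
      using that by (simp add: lookup_coeff_grade in_keys_iff)
    then have "coeff (grade F) (wt m) \<noteq> 0" by auto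
    then have "wt m \<le> 0" using le_degree assms(1) by metis
    then show ?thesis by (simp add: wt_eq_0_iff)
  qed
  then have "F = Poly_Mapping.single 0 (Poly_Mapping.lookup F 0)"
    by (intro poly_mapping_eqI) (auto simp: lookup_single when_def in_keys_iff)
  moreover define c where "c = Poly_Mapping.lookup F 0"
  ultimately have F: "F = Poly_Mapping.single 0 c" and "c \<noteq> 0" using assms(2) by auto
  then have "F * Poly_Mapping.single 0 (1 / c) = 1" by (simp add: mult_single)
  then show ?thesis by (metis dvd_triv_left)
qed

text \<open>Instead of showing that factors of a form are forms, the proof replaces them by their
  top homogeneous parts: leading coefficients under \<open>grade\<close> multiply, and that of
  \<open>monom F 3\<close> is \<open>F\<close> itself. Nonzero nonunits have positive degree, so the
  degrees are 1 and 2.\<close>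

lemma reducible_cubic_splits:
  assumes F: "homog 3 F" "F \<noteq> 0" "\<not> irreducible F"
  shows "splits F"
proof -
  have "\<not> F dvd 1"
  proof
    assume "F dvd 1"
    then obtain K where K: "1 = F * K" by (auto elim: dvdE)
    then have "grade F * grade K = 1" by (metis grade_def grade.ev_1 grade.ev_mult)
    then have "degree (grade F) + degree (grade K) = 0"
      by (metis degree_1 degree_mult_eq mult_zero_left mult_zero_right zero_neq_one)
    then show False using F by (simp add: grade_homog degree_monom_eq)
  qed
  then obtain G H where GH: "F = G * H" "\<not> G dvd 1" "\<not> H dvd 1"
    using F unfolding irreducible_def by blast
  then have nz: "G \<noteq> 0" "H \<noteq> 0" using F by auto
  have gr: "grade G * grade H = monom F 3"
    using GH(1) grade_homog[OF F(1)] by (metis grade_def grade.ev_mult)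
  then have grnz: "grade G \<noteq> 0" "grade H \<noteq> 0" using F(2) by auto
  have deg: "degree (grade G) + degree (grade H) = 3"
    using gr grnz F(2) by (metis degree_mult_eq degree_monom_eq)
  define G' H' where "G' = lead_coeff (grade G)" and "H' = lead_coeff (grade H)"
  have "G' * H' = F"
    using gr F(2) unfolding G'_def H'_def by (metis lead_coeff_mult lead_coeff_monom)
  have G': "wt m = degree (grade G)" if "m \<in> Poly_Mapping.keys G'" for m
    using that unfolding G'_def in_keys_iff lookup_coeff_grade by metis
  have H': "wt m = degree (grade H)" if "m \<in> Poly_Mapping.keys H'" for m
    using that unfolding H'_def in_keys_iff lookup_coeff_grade by metis
  have "degree (grade G) \<noteq> 0" "degree (grade H) \<noteq> 0"
    using is_unit_if_degree_grade_0 GH nz by blast+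
  with deg consider "degree (grade G) = 1" "degree (grade H) = 2" | "degree (grade G) = 2" "degree (grade H) = 1"
    by linarith
  then show ?thesis
  proof cases
    case 1
    then show ?thesis unfolding splits_def
      using linear_form_peval[of G'] quadratic_form_peval[of H'] G' H' \<open>G' * H' = F\<close> peval_mult by metis
  next
    case 2
    then show ?thesis unfolding splits_def
      using linear_form_peval[of H'] quadratic_form_peval[of G'] G' H' \<open>G' * H' = F\<close> peval_mult mult.commute by metis
  qed
qed

text \<open>Otherwise testing against the unit vectors shows that the cross product vanishes, and
  proportional vectors with this normalization agree.\<close>

lemma normalized_not_parallel:
  assumes "normalized p" "normalized q" "p \<noteq> q"
  shows "\<exists>r. det3 p q r \<noteq> 0"
proof (rule ccontr)
  assume "\<not> ?thesis"
  then have z: "det3 p q r = 0" for r by blast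
  from z[of "(1, 0, 0)"] z[of "(0, 1, 0)"] z[of "(0, 0, 1)"]
  have "cc p 1 * cc q 2 = cc p 2 * cc q 1" "cc p 0 * cc q 2 = cc p 2 * cc q 0" "cc p 0 * cc q 1 = cc p 1 * cc q 0"
    by (simp_all add: det3_def)
  with assms show False unfolding normalized_def cvec_eq_iff by auto
qed

text \<open>In coordinates with two of the base points at the singularities, every monomial left in the cubic is divisible by the third coordinate.\<close>
lemma two_singular_points_splits:
  assumes D: "cubic_expansion F D S"
    and sing: "peval F p = 0" "\<And>w. D p w = 0" "peval F q = 0" "\<And>w. D q w = 0"
    and r: "det3 p q r \<noteq> 0"
  shows "splits F"
proof -
  define z x y where "z v = det3 v q r / det3 p q r" and "x v = det3 p v r / det3 p q r"
    and "y v = det3 p q v / det3 p q r" for v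
  have form: "linear_form (\<lambda>v. k * (a * cc v 0 + (b * cc v 1 + c * cc v 2)))" for k a b c
    by (rule linear_form_cmult[OF linear_form_add[OF linear_form_cmult[OF linear_form_cc]
      linear_form_add[OF linear_form_cmult[OF linear_form_cc] linear_form_cmult[OF linear_form_cc]]]])
  have zxy: "z = (\<lambda>v. 1 / det3 p q r * ((cc q 1 * cc r 2 - cc q 2 * cc r 1) * cc v 0
      + ((cc q 2 * cc r 0 - cc q 0 * cc r 2) * cc v 1 + (cc q 0 * cc r 1 - cc q 1 * cc r 0) * cc v 2)))"
    "x = (\<lambda>v. 1 / det3 p q r * ((cc r 1 * cc p 2 - cc r 2 * cc p 1) * cc v 0
      + ((cc r 2 * cc p 0 - cc r 0 * cc p 2) * cc v 1 + (cc r 0 * cc p 1 - cc r 1 * cc p 0) * cc v 2)))"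
    "y = (\<lambda>v. 1 / det3 p q r * ((cc p 1 * cc q 2 - cc p 2 * cc q 1) * cc v 0
      + ((cc p 2 * cc q 0 - cc p 0 * cc q 2) * cc v 1 + (cc p 0 * cc q 1 - cc p 1 * cc q 0) * cc v 2)))"
    by (auto simp: z_def x_def y_def det3_def algebra_simps intro!: ext arg_cong2[where f = "(/)"])
  have lin: "linear_form z" "linear_form x" "linear_form y"
    by (simp_all only: zxy form)
  \<comment> \<open>Singularity at \<open>p\<close> and \<open>q\<close> leaves only the monomials
    \<open>zxy\<close>, \<open>zy^2\<close>, \<open>xy^2\<close> and \<open>y^3\<close>;
    \<open>h\<close> is the quotient by \<open>y\<close>.\<close>
  define h where "h v = S p q r * (z v * x v) + (D r p * (z v * y v) + (D r q * (x v * y v) + peval F r * (y v * y v)))" for v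
  have "quadratic_form h" unfolding h_def[abs_def]
    by (intro quadratic_form_add quadratic_form_cmult quadratic_form_mult lin)
  moreover have "peval F v = y v * h v" for v
  proof -
    have "v = vadd (vscale (z v) p) (vadd (vscale (x v) q) (vscale (y v) r))"
      unfolding z_def x_def y_def by (rule cramer[OF r])
    then have "peval F v = peval F (vadd (vscale (z v) p) (vadd (vscale (x v) q) (vscale (y v) r)))" by simp
    also have "\<dots> = y v * h v" unfolding cubic_expansionD(4)[OF D] h_def sing by (simp add: algebra_simps power2_eq_square power3_eq_cube)
    finally show ?thesis .
  qed
  ultimately show ?thesis unfolding splits_def using lin by blast
qed

subsection \<open>Points in general position\<close>

lemma cc_config [simp]: "cc (config x i) 0 = x (2 * i)" "cc (config x i) (Suc 0) = x (2 * i + 1)"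
  "cc (config x i) 2 = 1"
  by (simp_all add: config_def)

lemma normalized_config: "normalized (config x i)"
  by (simp add: normalized_def)

text \<open>Unisolvence for these three sets says, respectively, that no three of the points are collinear, that no
  six lie on a conic, and that no cubic through all eight is singular at one of them.\<close>
abbreviation "line_monomials \<equiv> {(1, 0), (0, 1 :: nat)} :: (nat \<times> nat) set"
abbreviation "conic_monomials \<equiv> {(1, 0), (0, 1), (2, 0), (1, 1), (0, 2)} :: (nat \<times> nat) set"
abbreviation "nodal_monomials \<equiv> {(2, 0), (1, 1), (0, 2), (3, 0), (2, 1), (1, 2), (0, 3)} :: (nat \<times> nat) set"

text \<open>Here \<open>K\<close> contains the centre; deleting it costs one element, which the
  strict inequality pays for.\<close>

lemma unisolventD:
  assumes "unisolvent J x" "K \<subseteq> {1..8}" "i0 \<in> K" "card J < card K"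
    and c: "\<And>j. j \<in> K \<Longrightarrow> j \<noteq> i0 \<Longrightarrow>
      (\<Sum>m\<in>J. c m * (x (2 * j) - x (2 * i0)) ^ fst m * (x (2 * j + 1) - x (2 * i0 + 1)) ^ snd m) = 0"
  shows "\<forall>m\<in>J. c m = (0 :: complex)"
proof -
  have "finite K" using assms(2) finite_subset by blast
  then have "card J \<le> card (K - {i0})" "K - {i0} \<subseteq> {1..8} - {i0}" "i0 \<in> {1..8}"
    using assms(2-4) by auto
  moreover have "\<forall>j\<in>K - {i0}. (\<Sum>m\<in>J. c m * (x (2 * j) - x (2 * i0)) ^ fst m
      * (x (2 * j + 1) - x (2 * i0 + 1)) ^ snd m) = 0"
    using c by blast
  ultimately show ?thesis using assms(1) unfolding unisolvent_def by blast
qed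

text \<open>Centred at a zero \<open>i0\<close>, the form has no constant term on the affine plane,
  so two further zeros kill both linear coefficients; the value at \<open>i0\<close> then kills the
  third coefficient of \<open>f\<close>.\<close>

lemma points_on_line:
  assumes "unisolvent line_monomials x" and f: "linear_form f" "f v \<noteq> 0"
  shows "card {j\<in>{1..8}. f (config x j) = 0} \<le> 2"
proof (rule ccontr)
  let ?K = "{j\<in>{1..8}. f (config x j) = 0}"
  assume "\<not> card ?K \<le> 2"
  then have K: "card line_monomials < card ?K" by simp
  then have "?K \<noteq> {}" by (metis card.empty not_less_zero)
  then obtain i0 where i0: "i0 \<in> ?K" by blast
  obtain l where l: "\<And>v. f v = dot3 l v" using f(1) unfolding linear_form_def by blast
  define c :: "nat \<times> nat \<Rightarrow> complex" where "c m = (if m = (1, 0) then cc l 0 else cc l 1)" for m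
  have "\<forall>m\<in>line_monomials. c m = 0"
  proof (rule unisolventD[OF assms(1) _ i0 K])
    fix j assume "j \<in> ?K"
    then have "f (config x j) - f (config x i0) = 0" using i0 by simp
    moreover have "(\<Sum>m\<in>line_monomials. c m * (x (2 * j) - x (2 * i0)) ^ fst m
        * (x (2 * j + 1) - x (2 * i0 + 1)) ^ snd m) = f (config x j) - f (config x i0)"
      by (simp add: c_def l dot3_def algebra_simps)
    ultimately show "(\<Sum>m\<in>line_monomials. c m * (x (2 * j) - x (2 * i0)) ^ fst m
        * (x (2 * j + 1) - x (2 * i0 + 1)) ^ snd m) = 0" by (simp only:)
  qed auto
  then have l01: "cc l 0 = 0" "cc l 1 = 0" by (auto simp: c_def)
  then have "cc l 2 = 0" using i0 by (simp add: l dot3_def)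
  with l01 show False using f(2) by (simp add: l dot3_def)
qed

lemma points_on_conic:
  assumes "unisolvent conic_monomials x" and f: "quadratic_form f" "f v \<noteq> 0"
  shows "card {j\<in>{1..8}. f (config x j) = 0} \<le> 5"
proof (rule ccontr)
  let ?K = "{j\<in>{1..8}. f (config x j) = 0}"
  assume "\<not> card ?K \<le> 5"
  then have K: "card conic_monomials < card ?K" by simp
  then have "?K \<noteq> {}" by (metis card.empty not_less_zero)
  then obtain i0 where i0: "i0 \<in> ?K" by blast
  obtain a b c d e g where q: "\<And>v. f v = a * cc v 0 ^ 2 + b * (cc v 0 * cc v 1) + c * cc v 1 ^ 2
     + d * (cc v 0 * cc v 2) + e * (cc v 1 * cc v 2) + g * cc v 2 ^ 2"
    using f(1) unfolding quadratic_form_def by blast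
  let ?X = "x (2 * i0)" and ?Y = "x (2 * i0 + 1)"
  \<comment> \<open>Taylor coefficients of the conic at the point \<open>i0\<close>; the last branch
    belongs to the monomial \<open>(0, 1)\<close>.\<close>
  define k :: "nat \<times> nat \<Rightarrow> complex" where "k m =
    (if m = (2, 0) then a else if m = (1, 1) then b else if m = (0, 2) then c
     else if m = (1, 0) then 2 * a * ?X + b * ?Y + d else 2 * c * ?Y + b * ?X + e)" for m
  have "\<forall>m\<in>conic_monomials. k m = 0"
  proof (rule unisolventD[OF assms(1) _ i0 K])
    fix j assume "j \<in> ?K"
    then have "f (config x j) - f (config x i0) = 0" using i0 by simp
    moreover have "(\<Sum>m\<in>conic_monomials. k m * (x (2 * j) - x (2 * i0)) ^ fst m
        * (x (2 * j + 1) - x (2 * i0 + 1)) ^ snd m) = f (config x j) - f (config x i0)"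
      by (simp add: k_def q algebra_simps power2_eq_square)
    ultimately show "(\<Sum>m\<in>conic_monomials. k m * (x (2 * j) - x (2 * i0)) ^ fst m
        * (x (2 * j + 1) - x (2 * i0 + 1)) ^ snd m) = 0" by (simp only:)
  qed auto
  then have z: "a = 0" "b = 0" "c = 0" "d = 0" "e = 0" by (auto simp: k_def)
  then have "g = 0" using i0 by (simp add: q)
  with z show False using f(2) by (simp add: q)
qed

lemma not_splits_if_general:
  assumes gen: "unisolvent line_monomials x" "unisolvent conic_monomials x"
    and F: "peval F v \<noteq> 0" "\<And>i. i \<in> {1..8} \<Longrightarrow> peval F (config x i) = 0"
  shows "\<not> splits F"
proof
  assume "splits F"
  then obtain f h where fh: "linear_form f" "quadratic_form h" "\<And>v. peval F v = f v * h v"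
    unfolding splits_def by blast
  have nz: "f v \<noteq> 0" "h v \<noteq> 0" using F(1) fh(3)[of v] by auto
  define A B where "A = {j\<in>{1..8::nat}. f (config x j) = 0}" and "B = {j\<in>{1..8::nat}. h (config x j) = 0}"
  have "f (config x j) = 0 \<or> h (config x j) = 0" if "j \<in> {1..8}" for j
    using F(2)[OF that] fh(3) by simp
  then have "{1..8} \<subseteq> A \<union> B" unfolding A_def B_def by blast
  moreover have "finite (A \<union> B)" by (simp add: A_def B_def)
  ultimately have "card {1..8::nat} \<le> card (A \<union> B)" by (rule card_mono[rotated])
  also have "\<dots> \<le> card A + card B" by (rule card_Un_le)
  also have "card A \<le> 2" unfolding A_def by (rule points_on_line[OF gen(1) fh(1) nz(1)])
  also have "card B \<le> 5" unfolding B_def by (rule points_on_conic[OF gen(2) fh(2) nz(2)])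
  finally show False by simp
qed

text \<open>In affine coordinates centred at the base point, a singular cubic keeps only its seven
  coefficients of degrees 2 and 3. The seven other points force these to vanish, so the cubic would
  vanish on a whole chart.\<close>

lemma not_singular_at_base_point:
  assumes gen: "unisolvent nodal_monomials x" and i0: "i0 \<in> {1..8}"
    and F: "homog 3 F" "F \<noteq> 0" "\<And>i. i \<in> {1..8} \<Longrightarrow> peval F (config x i) = 0"
    and D: "cubic_expansion F D S"
  shows "\<exists>w. D (config x i0) w \<noteq> 0"
proof (rule ccontr)
  let ?p = "config x i0" and ?A = "(1, 0, 0) :: cvec" and ?B = "(0, 1, 0) :: cvec"
  assume "\<not> ?thesis"
  then have sing: "D ?p w = 0" for w by blast
  define k :: "nat \<times> nat \<Rightarrow> complex" where "k m =
    (if m = (2, 0) then D ?A ?p else if m = (1, 1) then S ?p ?A ?B else if m = (0, 2) then D ?B ?p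
     else if m = (3, 0) then peval F ?A else if m = (2, 1) then D ?A ?B
     else if m = (1, 2) then D ?B ?A else peval F ?B)" for m
  have exp: "peval F (vadd ?p (vadd (vscale u ?A) (vscale y ?B))) = (\<Sum>m\<in>nodal_monomials. k m * u ^ fst m * y ^ snd m)" for u y
    using cubic_expansionD(4)[OF D, of 1 ?p u ?A y ?B] F(3)[OF i0] sing by (simp add: k_def mult_ac)
  have K: "card nodal_monomials < card {1..8::nat}" by simp
  have "\<forall>m\<in>nodal_monomials. k m = 0"
  proof (rule unisolventD[OF gen _ i0 K])
    fix j :: nat assume j: "j \<in> {1..8}"
    have "config x j = vadd ?p (vadd (vscale (x (2 * j) - x (2 * i0)) ?A) (vscale (x (2 * j + 1) - x (2 * i0 + 1)) ?B))"
      by (simp add: cvec_eq_iff)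
    with F(3)[OF j] show "(\<Sum>m\<in>nodal_monomials. k m * (x (2 * j) - x (2 * i0)) ^ fst m
        * (x (2 * j + 1) - x (2 * i0 + 1)) ^ snd m) = 0"
      by (simp only: exp)
  qed simp
  then have "peval F (vadd ?p (vadd (vscale u ?A) (vscale y ?B))) = 0" for u y
    unfolding exp by (intro sum.neutral) simp
  moreover have "det3 ?p ?A ?B \<noteq> 0" by (simp add: det3_def)
  ultimately show False using exists_chart_nonzero[OF F(1,2)] by metis
qed

subsection \<open>Multiplicities in charts\<close>

text \<open>The frame chosen by \<open>SOME\<close> does not depend on \<open>F\<close>. Fixing it
  for all \<open>F\<close> at once lets a product and its factors be compared in the same
  chart.\<close>

lemma curve_chart:
  assumes "normalized p"
  obtains A B where "det3 p A B \<noteq> 0"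
    "\<And>F. curve_mult F p = ord2 (\<lambda>x y. peval F (vadd p (vadd (vscale x A) (vscale y B))))"
proof -
  define AB where "AB = (SOME AB. det3 p (fst AB) (snd AB) \<noteq> 0)"
  have "\<exists>A B. det3 p A B \<noteq> 0"
  proof -
    consider "cc p 2 \<noteq> 0" | "cc p 1 \<noteq> 0" | "cc p 0 \<noteq> 0"
      using assms unfolding normalized_def by fastforce
    then show ?thesis
    proof cases
      case 1 then have "det3 p (1, 0, 0) (0, 1, 0) \<noteq> 0" by (simp add: det3_def)
      then show ?thesis by blast
    next
      case 2 then have "det3 p (1, 0, 0) (0, 0, 1) \<noteq> 0" by (simp add: det3_def)
      then show ?thesis by blast
    next
      case 3 then have "det3 p (0, 1, 0) (0, 0, 1) \<noteq> 0" by (simp add: det3_def)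
      then show ?thesis by blast
    qed
  qed
  then have "\<exists>AB. det3 p (fst AB) (snd AB) \<noteq> 0" by auto
  then have "det3 p (fst AB) (snd AB) \<noteq> 0" unfolding AB_def by (rule someI_ex)
  then show ?thesis
    by (rule that) (simp only: curve_mult_def AB_def Let_def)
qed

lemma exc_chart:
  assumes "cc P 2 = 1" "normalized L" "dot3 L P = 0"
  obtains R B where "det3 P R B \<noteq> 0"
    "\<And>F. exc_ord F P L = ord2 (\<lambda>x t. peval F (vadd P (vadd (vscale x R) (vscale (x * t) B))))"
proof -
  let ?good = "\<lambda>RB. dot3 L (fst RB) = 0 \<and> dot3 L (snd RB) \<noteq> 0 \<and> det3 P (fst RB) (snd RB) \<noteq> 0"
  define RB where "RB = (SOME RB. ?good RB)"
  have "cc L 0 \<noteq> 0 \<or> cc L 1 \<noteq> 0"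
    using assms unfolding normalized_def dot3_def by auto
  \<comment> \<open>\<open>L\<close> contains the affine point \<open>P\<close>, so it is not the
    line at infinity. Its own point at infinity serves as \<open>R\<close>, and one of the two axis
    directions lies off \<open>L\<close>.\<close>
  then have "?good ((cc L 1, - cc L 0, 0), (1, 0, 0)) \<or> ?good ((cc L 1, - cc L 0, 0), (0, 1, 0))"
    using assms(1) by (auto simp: dot3_def det3_def)
  then have "\<exists>RB. ?good RB" by blast
  then have "?good RB" unfolding RB_def by (rule someI_ex)
  then show ?thesis
    
  proof (intro that[of "fst RB" "snd RB"])
    show "exc_ord F P L = ord2 (\<lambda>x t. peval F (vadd P (vadd (vscale x (fst RB)) (vscale (x * t) (snd RB)))))" for F
      by (simp only: exc_ord_def RB_def Let_def)
  qed blast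
qed

section \<open>Charts as bivariate polynomials, and orders of products\<close>

lemma curve_chart_poly2:
  "\<exists>H. \<forall>x y. peval F (vadd p (vadd (vscale x A) (vscale y B))) = poly2 H x y"
proof (intro exI allI)
  fix x y
  have "cc (vadd p (vadd (vscale x A) (vscale y B))) = (\<lambda>i. poly2 [:[:cc p i, cc A i:], [:cc B i:]:] x y)"
    by (rule ext) (simp add: poly2_def)
  then show "peval F (vadd p (vadd (vscale x A) (vscale y B)))
      = poly2 (ev (\<lambda>c. [:[:c:]:]) (\<lambda>i. [:[:cc p i, cc A i:], [:cc B i:]:]) F) x y"
    by (subst hom_ev[where \<psi> = "\<lambda>H. poly2 H x y"])
      (simp_all add: poly2_add poly2_mult poly2_0 poly2_1 peval_eq_ev, simp add: poly2_def)
qed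

lemma exc_chart_poly2:
  "\<exists>H. \<forall>x t. peval F (vadd P (vadd (vscale x R) (vscale (x * t) B))) = poly2 H x t"
proof (intro exI allI)
  fix x t
  have "cc (vadd P (vadd (vscale x R) (vscale (x * t) B))) = (\<lambda>i. poly2 [:[:cc P i, cc R i:], [:0, cc B i:]:] x t)"
    by (rule ext) (simp add: poly2_def algebra_simps)
  then show "peval F (vadd P (vadd (vscale x R) (vscale (x * t) B)))
      = poly2 (ev (\<lambda>c. [:[:c:]:]) (\<lambda>i. [:[:cc P i, cc R i:], [:0, cc B i:]:]) F) x t"
    by (subst hom_ev[where \<psi> = "\<lambda>H. poly2 H x t"])
      (simp_all add: poly2_add poly2_mult poly2_0 poly2_1 peval_eq_ev, simp add: poly2_def)
qed

text \<open>Away from \<open>x = 0\<close> the blow-up chart is the affine chart with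
  \<open>t = y / x\<close>.\<close>

lemma exc_chart_nonzero:
  assumes "homog n F" "F \<noteq> 0" "det3 P R B \<noteq> 0"
  shows "\<exists>x t. peval F (vadd P (vadd (vscale x R) (vscale (x * t) B))) \<noteq> 0"
proof -
  obtain x y where "x \<noteq> 0" "peval F (vadd P (vadd (vscale x R) (vscale y B))) \<noteq> 0"
    using exists_chart_nonzero[OF assms] by blast
  then have "peval F (vadd P (vadd (vscale x R) (vscale (x * (y / x)) B))) \<noteq> 0" by simp
  then show ?thesis by blast
qed

lemma ord2_mult_ge:
  assumes "\<exists>H. \<forall>x y. f x y = poly2 H x y" "\<exists>H. \<forall>x y. g x y = poly2 H x y"
    and "\<exists>x y. f x y * g x y \<noteq> 0" and "a \<le> ord2 f" "b \<le> ord2 g"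
  shows "a + b \<le> ord2 (\<lambda>x y. f x y * g x y)"
proof -
  obtain H K where H: "\<And>x y. f x y = poly2 H x y" and K: "\<And>x y. g x y = poly2 K x y"
    using assms by blast
  obtain x y where nz: "f x y * g x y \<noteq> 0" using assms by blast
  have "vanishes a f" "vanishes b g"
    using assms nz ord2_ge_iff_vanishes[of f H x y a] ord2_ge_iff_vanishes[of g K x y b] H K by auto
  then have "vanishes (a + b) (\<lambda>x y. f x y * g x y)" by (rule vanishes_mult)
  then show ?thesis
    using ord2_ge_iff_vanishes[of "\<lambda>x y. f x y * g x y" "H * K" x y "a + b"] H K nz
    by (simp add: poly2_mult)
qed

lemma curve_mult_mult_ge:
  assumes "normalized p" "homog n F" "homog k G" "F \<noteq> 0" "G \<noteq> 0"
    "a \<le> curve_mult F p" "b \<le> curve_mult G p"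
  shows "a + b \<le> curve_mult (F * G) p"
proof -
  obtain A B where AB: "det3 p A B \<noteq> 0"
    "\<And>F. curve_mult F p = ord2 (\<lambda>x y. peval F (vadd p (vadd (vscale x A) (vscale y B))))"
    using curve_chart[OF assms(1)] by blast
  obtain x y where "peval (F * G) (vadd p (vadd (vscale x A) (vscale y B))) \<noteq> 0"
    using exists_chart_nonzero[OF homog_mult[OF assms(2,3)] _ AB(1)] assms(4,5) by auto
  then show ?thesis
    using assms(6,7) unfolding AB(2) peval_mult
    by (intro ord2_mult_ge curve_chart_poly2) blast+
qed

lemma exc_ord_mult_ge:
  assumes "cc P 2 = 1" "normalized L" "dot3 L P = 0" "homog n F" "homog k G" "F \<noteq> 0" "G \<noteq> 0"
    "a \<le> exc_ord F P L" "b \<le> exc_ord G P L"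
  shows "a + b \<le> exc_ord (F * G) P L"
proof -
  obtain R B where RB: "det3 P R B \<noteq> 0"
    "\<And>F. exc_ord F P L = ord2 (\<lambda>x t. peval F (vadd P (vadd (vscale x R) (vscale (x * t) B))))"
    using exc_chart[OF assms(1-3)] by blast
  obtain x t where "peval (F * G) (vadd P (vadd (vscale x R) (vscale (x * t) B))) \<noteq> 0"
    using exc_chart_nonzero[OF homog_mult[OF assms(4,5)] _ RB(1)] assms(6,7) by auto
  then show ?thesis
    using assms(8,9) unfolding RB(2) peval_mult
    by (intro ord2_mult_ge exc_chart_poly2) blast+
qed

lemma ord2_ge_1_iff:
  assumes "\<exists>H. \<forall>x y. h x y = poly2 H x y" "\<exists>x y. h x y \<noteq> 0"
  shows "1 \<le> ord2 h \<longleftrightarrow> h 0 0 = 0"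
proof -
  obtain H x y where H: "\<And>x y. h x y = poly2 H x y" and nz: "h x y \<noteq> 0" using assms by blast
  have "h 0 0 = coeff (coeff H 0) 0" by (simp add: H poly2_def poly_0_coeff_0)
  then show ?thesis using ord2_ge_iff[OF H nz, of 1] by auto
qed

lemma vadd_vscale_0 [simp]: "vadd p (vadd (vscale 0 A) (vscale 0 B)) = p"
  by (simp add: cvec_eq_iff)

lemma curve_mult_ge_1_iff:
  assumes "normalized p" "homog n F" "F \<noteq> 0"
  shows "1 \<le> curve_mult F p \<longleftrightarrow> peval F p = 0"
proof -
  obtain A B where AB: "det3 p A B \<noteq> 0"
    "\<And>F. curve_mult F p = ord2 (\<lambda>x y. peval F (vadd p (vadd (vscale x A) (vscale y B))))"
    using curve_chart[OF assms(1)] by blast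
  show ?thesis
    unfolding AB(2) using exists_chart_nonzero[OF assms(2,3) AB(1)]
    by (subst ord2_ge_1_iff) (use curve_chart_poly2 in auto)
qed

lemma exc_ord_ge_1:
  assumes "cc P 2 = 1" "normalized L" "dot3 L P = 0" "homog n F" "F \<noteq> 0" "peval F P = 0"
  shows "1 \<le> exc_ord F P L"
proof -
  obtain R B where RB: "det3 P R B \<noteq> 0"
    "\<And>F. exc_ord F P L = ord2 (\<lambda>x t. peval F (vadd P (vadd (vscale x R) (vscale (x * t) B))))"
    using exc_chart[OF assms(1-3)] by blast
  show ?thesis
    unfolding RB(2) using exc_chart_nonzero[OF assms(4,5) RB(1)] assms(6)
    by (subst ord2_ge_1_iff) (use exc_chart_poly2 in auto)
qed

lemma curve_mult_ge_2D:
  assumes p: "normalized p" and F: "homog 3 F" "F \<noteq> 0" and mult: "2 \<le> curve_mult F p"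
    and D: "cubic_expansion F D S"
  shows "peval F p = 0" "D p w = 0"
proof -
  obtain A B where AB: "det3 p A B \<noteq> 0"
    "\<And>F. curve_mult F p = ord2 (\<lambda>x y. peval F (vadd p (vadd (vscale x A) (vscale y B))))"
    using curve_chart[OF p] by blast
  obtain x0 y0 where nz: "peval F (vadd p (vadd (vscale x0 A) (vscale y0 B))) \<noteq> 0"
    using exists_chart_nonzero[OF F AB(1)] by blast
  \<comment> \<open>Counting from 0, entry \<open>k\<close> of the inner list \<open>j\<close> is
    the coefficient of \<open>x^k y^j\<close>.\<close>
  define H where "H = [:[:peval F p, D p A, D A p, peval F A:], [:D p B, S p A B, D A B:],
    [:D B p, D B A:], [:peval F B:]:]"
  have H: "peval F (vadd p (vadd (vscale x A) (vscale y B))) = poly2 H x y" for x y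
    using cubic_expansionD(4)[OF D, of 1 p x A y B] by (simp add: H_def poly2_def algebra_simps power2_eq_square power3_eq_cube)
  have *: "coeff (coeff H j) k = 0" if "k + j < 2" for k j
    using mult that unfolding AB(2) ord2_ge_iff[of "\<lambda>x y. peval F (vadd p (vadd (vscale x A) (vscale y B)))", OF H nz]
    by blast
  show Fp: "peval F p = 0" using *[of 0 0] by (simp add: H_def)
  have "D p A = 0" using *[of 1 0] by (simp add: H_def)
  moreover have "D p B = 0" using *[of 0 1] by (simp add: H_def)
  ultimately show "D p w = 0" by (rule singular_if_frame[OF D AB(1) Fp])
qed

text \<open>Substituting \<open>y = x * t\<close> moves the coefficient \<open>D P B\<close> from
  \<open>y\<close> to \<open>x * t\<close>, of degree 2. So order 2 only sees the tangent direction
  \<open>R\<close>, whereas order 3 makes the cubic singular at \<open>P\<close>.\<close>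

lemma exc_ord_ge_iff:
  assumes P: "cc P 2 = 1" and L: "normalized L" "dot3 L P = 0" and F: "homog 3 F" "F \<noteq> 0"
    and D: "cubic_expansion F D S"
    and RB: "det3 P R B \<noteq> 0"
      "\<And>F. exc_ord F P L = ord2 (\<lambda>x t. peval F (vadd P (vadd (vscale x R) (vscale (x * t) B))))"
  shows "2 \<le> exc_ord F P L \<longleftrightarrow> peval F P = 0 \<and> D P R = 0"
    and "3 \<le> exc_ord F P L \<Longrightarrow> peval F P = 0 \<and> D P R = 0 \<and> D P B = 0"
proof -
  obtain x0 t0 where nz: "peval F (vadd P (vadd (vscale x0 R) (vscale (x0 * t0) B))) \<noteq> 0"
    using exc_chart_nonzero[OF F RB(1)] by blast
  define H where "H = [:[:peval F P, D P R, D R P, peval F R:], [:0, D P B, S P R B, D R B:],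
    [:0, 0, D B P, D B R:], [:0, 0, 0, peval F B:]:]"
  have H: "peval F (vadd P (vadd (vscale x R) (vscale (x * t) B))) = poly2 H x t" for x t
    using cubic_expansionD(4)[OF D, of 1 P x R "x * t" B] by (simp add: H_def poly2_def algebra_simps power2_eq_square power3_eq_cube)
  have iff: "n \<le> exc_ord F P L \<longleftrightarrow> (\<forall>k j. k + j < n \<longrightarrow> coeff (coeff H j) k = 0)" for n
    unfolding RB(2) by (rule ord2_ge_iff[of "\<lambda>x t. peval F (vadd P (vadd (vscale x R) (vscale (x * t) B)))", OF H nz])
  show "2 \<le> exc_ord F P L \<longleftrightarrow> peval F P = 0 \<and> D P R = 0"
  proof
    assume "2 \<le> exc_ord F P L"
    then have "coeff (coeff H 0) 0 = 0" "coeff (coeff H 0) 1 = 0" unfolding iff by simp_all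
    then show "peval F P = 0 \<and> D P R = 0" by (simp add: H_def)
  next
    assume sing: "peval F P = 0 \<and> D P R = 0"
    have "coeff (coeff H j) k = 0" if "k + j < 2" for k j
    proof -
      have "k = 0 \<and> j = 0 \<or> k = 1 \<and> j = 0 \<or> k = 0 \<and> j = 1" using that by arith
      then show ?thesis using sing by (auto simp: H_def)
    qed
    then show "2 \<le> exc_ord F P L" unfolding iff by blast
  qed
  assume "3 \<le> exc_ord F P L"
  then have "coeff (coeff H 0) 0 = 0" "coeff (coeff H 0) 1 = 0" "coeff (coeff H 1) 1 = 0"
    unfolding iff by simp_all
  then show "peval F P = 0 \<and> D P R = 0 \<and> D P B = 0" by (simp add: H_def)
qed

subsection \<open>Sections with prescribed double points\<close>

interpretation const_poly: coeff_hom "\<lambda>c. [:c:] :: complex poly"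
  by standard simp_all

text \<open>Ternary cubics have ten monomials, one more than the number of conditions. Additivity
  and the rule on monomials together express linearity of \<open>\<phi> k\<close>.\<close>

lemma exists_cubic_killed_by:
  fixes \<phi> :: "nat \<Rightarrow> mpoly \<Rightarrow> complex"
  assumes add: "\<And>k F G. \<phi> k (F + G) = \<phi> k F + \<phi> k G"
    and scale: "\<And>k m c. \<phi> k (Poly_Mapping.single m c) = c * \<phi> k (Poly_Mapping.single m 1)"
  obtains F where "F \<noteq> 0" "homog 3 F" "\<And>k. k < 9 \<Longrightarrow> \<phi> k F = 0"
proof -
  define I :: "(nat \<times> nat) set" where "I = (SIGMA i:{..3}. {..3 - i})"
  define mm :: "nat \<times> nat \<Rightarrow> nat \<Rightarrow>\<^sub>0 nat" where
    "mm ij = Poly_Mapping.single 0 (fst ij) + Poly_Mapping.single 1 (snd ij) + Poly_Mapping.single 2 (3 - fst ij - snd ij)" for ij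
  have "card I = 10" by (simp add: I_def numeral_eq_Suc)
  have finI: "finite I" by (simp add: I_def)
  have "card {..<9::nat} < card I" by (simp add: \<open>card I = 10\<close>)
  then obtain c where c: "\<exists>ij\<in>I. c ij \<noteq> 0" "\<forall>k\<in>{..<9}. (\<Sum>ij\<in>I. c ij * \<phi> k (Poly_Mapping.single (mm ij) 1)) = 0"
    using underdetermined_system[of "{..<9::nat}" I "\<lambda>k ij. \<phi> k (Poly_Mapping.single (mm ij) 1)"] finI by auto
  define F where "F = (\<Sum>ij\<in>I. Poly_Mapping.single (mm ij) (c ij))"
  have lookup_mm: "Poly_Mapping.lookup (mm ij) 0 = fst ij" "Poly_Mapping.lookup (mm ij) 1 = snd ij" for ij
    by (simp_all add: mm_def lookup_add lookup_single)
  then have inj: "mm ij = mm ij' \<longleftrightarrow> ij = ij'" for ij ij' by (metis prod.expand)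
  obtain ij where ij: "ij \<in> I" "c ij \<noteq> 0" using c(1) by blast
  have "Poly_Mapping.lookup F (mm ij) = (\<Sum>ij'\<in>I. if ij' = ij then c ij' else 0)"
    unfolding F_def lookup_sum by (rule sum.cong) (auto simp: lookup_single inj)
  also have "\<dots> = c ij" using finI ij(1) by simp
  finally have "F \<noteq> 0" using ij(2) by auto
  moreover have "homog 3 F"
    unfolding homog_iff_wt
  proof
    fix m assume "m \<in> Poly_Mapping.keys F"
    then obtain ij where "ij \<in> I" and m: "m = mm ij"
      unfolding F_def using keys_sum[of "\<lambda>ij. Poly_Mapping.single (mm ij) (c ij)" I]
      by (fastforce split: if_splits)
    then have "fst ij + snd ij \<le> 3" by (auto simp: I_def)
    then have "wt m = 3" unfolding m mm_def by (simp add: wt_add)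
    moreover have "Poly_Mapping.keys m \<subseteq> {0, 1, 2}"
      by (auto simp: m mm_def in_keys_iff lookup_add lookup_single when_def split: if_splits)
    ultimately show "Poly_Mapping.keys m \<subseteq> {0, 1, 2} \<and> wt m = 3" by blast
  qed
  moreover have "\<phi> k F = 0" if "k < 9" for k
  proof -
    have "\<phi> k 0 = 0" using add[of k 0 0] by simp
    then have "\<phi> k (\<Sum>ij\<in>A. f ij) = (\<Sum>ij\<in>A. \<phi> k (f ij))" for A :: "(nat \<times> nat) set" and f
      by (induction A rule: infinite_finite_induct) (simp_all add: add)
    then have "\<phi> k F = (\<Sum>ij\<in>I. c ij * \<phi> k (Poly_Mapping.single (mm ij) 1))"
      unfolding F_def by (simp add: scale[of k _ "c _"])
    then show ?thesis using c(2) that by simp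
  qed
  ultimately show ?thesis by (rule that)
qed

lemma exists_cubic_through:
  fixes Ps :: "nat \<Rightarrow> cvec" and \<psi> :: "mpoly \<Rightarrow> complex"
  assumes add: "\<And>F G. \<psi> (F + G) = \<psi> F + \<psi> G"
    and scale: "\<And>m c. \<psi> (Poly_Mapping.single m c) = c * \<psi> (Poly_Mapping.single m 1)"
  obtains F where "F \<noteq> 0" "homog 3 F" "\<And>i. i \<in> {1..8} \<Longrightarrow> peval F (Ps i) = 0" "\<psi> F = 0"
proof -
  \<comment> \<open>Indices 0 to 7 stand for the points 1 to 8, and index 8 for the free condition
    \<open>\<psi>\<close>.\<close>
  define \<phi> where "\<phi> k F = (if k < 8 then peval F (Ps (Suc k)) else \<psi> F)" for k :: nat and F
  have "\<phi> k (F + G) = \<phi> k F + \<phi> k G" for k F G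
    by (simp add: \<phi>_def add peval_eq_ev meval.ev_add)
  moreover have "\<phi> k (Poly_Mapping.single m c) = c * \<phi> k (Poly_Mapping.single m 1)" for k m c
    unfolding \<phi>_def using scale[of m c] by (simp add: peval_eq_ev meval.ev_single)
  ultimately obtain F where F: "F \<noteq> 0" "homog 3 F" "\<And>k. k < 9 \<Longrightarrow> \<phi> k F = 0"
    using exists_cubic_killed_by[of \<phi>] by blast
  have "peval F (Ps i) = 0" if "i \<in> {1..8}" for i
  proof -
    have "i - 1 < 9" "i - 1 < 8" "Suc (i - 1) = i" using that by auto
    then show ?thesis using F(3)[of "i - 1"] by (simp add: \<phi>_def)
  qed
  moreover have "\<psi> F = 0" using F(3)[of 8] by (simp add: \<phi>_def)
  ultimately show ?thesis using F by (intro that) auto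
qed

text \<open>The multiplicity at an exceptional point is a truncated difference, so it is additive only together
  with the lower bound \<open>d\<close> on the order in the chart.\<close>
fun mult_ge :: "(nat \<Rightarrow> cvec) \<Rightarrow> nat \<Rightarrow> mpoly \<Rightarrow> nat \<Rightarrow> s8pt \<Rightarrow> bool" where
  "mult_ge Ps d F k (Pt p) \<longleftrightarrow> k \<le> curve_mult F p"
| "mult_ge Ps d F k (Ex i L) \<longleftrightarrow> d + k \<le> exc_ord F (Ps i) L"

lemma mult_ge_imp: "mult_ge Ps d F k q \<Longrightarrow> k \<le> div_mult Ps d F q"
  by (cases q) auto

lemma mult_ge_mult:
  assumes "q \<in> S8 (config x)" "homog n F" "homog n' G" "F \<noteq> 0" "G \<noteq> 0"
    "mult_ge (config x) d F k q" "mult_ge (config x) d' G k' q"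
  shows "mult_ge (config x) (d + d') (F * G) (k + k') q"
proof (cases q)
  case (Pt p)
  then show ?thesis using assms curve_mult_mult_ge[of p n F n' G k k'] by (auto simp: S8_def)
next
  case (Ex i L)
  then have "d + k + (d' + k') \<le> exc_ord (F * G) (config x i) L"
    using assms by (intro exc_ord_mult_ge[where n = n and k = n']) (auto simp: S8_def)
  then show ?thesis using Ex by simp
qed

lemma exists_cubic_through_point:
  assumes "q \<in> S8 (config x)"
  obtains F where "F \<noteq> 0" "homog 3 F" "\<And>i. i \<in> {1..8} \<Longrightarrow> peval F (config x i) = 0"
    "mult_ge (config x) 1 F 1 q"
proof (cases q)
  case (Pt p)
  have p: "normalized p" using assms Pt by (auto simp: S8_def)
  obtain F where F: "F \<noteq> 0" "homog 3 F" "\<And>i. i \<in> {1..8} \<Longrightarrow> peval F (config x i) = 0" "peval F p = 0"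
    using exists_cubic_through[of "\<lambda>F. peval F p" "config x"]
    by (metis meval.ev_add meval.ev_single mult_1 peval_eq_ev)
  then show ?thesis using curve_mult_ge_1_iff[OF p F(2,1)] by (intro that) (auto simp: Pt)
next
  case (Ex i L)
  then have i: "i \<in> {1..8}" and L: "normalized L" "dot3 L (config x i) = 0"
    using assms by (auto simp: S8_def)
  let ?P = "config x i"
  obtain R B where RB: "det3 ?P R B \<noteq> 0"
    "\<And>F. exc_ord F ?P L = ord2 (\<lambda>x t. peval F (vadd ?P (vadd (vscale x R) (vscale (x * t) B))))"
    using exc_chart[OF cc_config(3) L] by blast
  \<comment> \<open>The linear coefficient of \<open>F\<close> along the line through
    \<open>?P\<close> in direction \<open>R\<close> is \<open>D ?P R\<close>. It is expressed
    through \<open>U\<close> because \<open>D\<close> is available only after \<open>F\<close> has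
    been chosen.\<close>
  define U where "U = ev (\<lambda>c. [:c:]) (\<lambda>j. [:cc ?P j, cc R j:])"
  have "coeff (U (F + G)) 1 = coeff (U F) 1 + coeff (U G) 1" for F G
    by (simp add: U_def const_poly.ev_add)
  moreover have "coeff (U (Poly_Mapping.single m c)) 1 = c * coeff (U (Poly_Mapping.single m 1)) 1" for m c
    by (simp add: U_def const_poly.ev_single)
  ultimately obtain F where F: "F \<noteq> 0" "homog 3 F" "\<And>i. i \<in> {1..8} \<Longrightarrow> peval F (config x i) = 0"
    "coeff (U F) 1 = 0"
    using exists_cubic_through[of "\<lambda>F. coeff (U F) 1" "config x"] by blast
  obtain D S where D: "cubic_expansion F D S" using cubic_expansion_exists[OF F(2)] by blast
  have "poly (U F) s = poly [:peval F ?P, D ?P R, D R ?P, peval F R:] s" for s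
  proof -
    have "vadd ?P (vscale s R) = vadd (vscale 1 ?P) (vadd (vscale s R) (vscale 0 R))"
      by (simp add: cvec_eq_iff)
    then have "poly (U F) s = peval F (vadd (vscale 1 ?P) (vadd (vscale s R) (vscale 0 R)))"
      by (simp only: U_def poly_ev_line)
    also have "\<dots> = poly [:peval F ?P, D ?P R, D R ?P, peval F R:] s"
      unfolding cubic_expansionD(4)[OF D] by (simp add: algebra_simps power2_eq_square power3_eq_cube)
    finally show ?thesis .
  qed
  then have "U F = [:peval F ?P, D ?P R, D R ?P, peval F R:]"
    by (intro iffD1[OF poly_eq_poly_eq_iff] ext)
  then have "D ?P R = 0" using F(4) by simp
  then have "2 \<le> exc_ord F ?P L"
    using exc_ord_ge_iff(1)[OF _ L F(2,1) D RB] F(3)[OF i] by simp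
  then show ?thesis using F by (intro that) (auto simp: Ex)
qed

lemma mult_ge_0_if_section:
  assumes "q \<in> S8 (config x)" "homog 3 F" "F \<noteq> 0" "\<And>i. i \<in> {1..8} \<Longrightarrow> peval F (config x i) = 0"
  shows "mult_ge (config x) 1 F 0 q"
  using assms exc_ord_ge_1[of "config x _" _ 3 F] by (cases q) (auto simp: S8_def)

text \<open>The induction also carries order at least \<open>d\<close> at every exceptional point: a
  factor of smaller order there would spoil the sum of the bounds at a point added later. Each step
  raises \<open>d\<close> by 2, one for each copy of \<open>G\<close>.\<close>

lemma exists_section_mult_ge_2:
  assumes "finite Z" "Z \<subseteq> S8 (config x)"
  shows "\<exists>d F. is_section (config x) d F \<and> (\<forall>q\<in>S8 (config x). mult_ge (config x) d F 0 q)
    \<and> (\<forall>q\<in>Z. mult_ge (config x) d F 2 q)"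
  using assms
proof (induction Z rule: finite_induct)
  case empty
  have "homog 0 1" by (simp add: homog_iff_wt)
  then have "is_section (config x) 0 1" by (simp add: is_section_def)
  moreover have "mult_ge (config x) 0 1 0 q" for q by (cases q) auto
  ultimately show ?case by blast
next
  case (insert q Z)
  then obtain d F where sec: "is_section (config x) d F" and F0: "\<And>q. q \<in> S8 (config x) \<Longrightarrow> mult_ge (config x) d F 0 q"
    and FZ: "\<And>q. q \<in> Z \<Longrightarrow> mult_ge (config x) d F 2 q" by auto
  from sec have F: "F \<noteq> 0" "homog (3 * d) F" "\<And>i. i \<in> {1..8} \<Longrightarrow> d \<le> curve_mult F (config x i)"
    by (auto simp: is_section_def)
  obtain G where G: "G \<noteq> 0" "homog 3 G" "\<And>i. i \<in> {1..8} \<Longrightarrow> peval G (config x i) = 0"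
    "mult_ge (config x) 1 G 1 q"
    using exists_cubic_through_point insert.prems by blast
  have G0: "mult_ge (config x) 1 G 0 q'" if "q' \<in> S8 (config x)" for q'
    using mult_ge_0_if_section[OF that G(2,1,3)] .
  have Gi: "1 \<le> curve_mult G (config x i)" if "i \<in> {1..8}" for i
    using curve_mult_ge_1_iff[OF normalized_config G(2,1)] G(3)[OF that] by simp
  have GG: "homog (3 + 3) (G * G)" "G * G \<noteq> 0" using homog_mult[OF G(2,2)] G(1) by auto
  have GGm: "mult_ge (config x) (1 + 1) (G * G) (k + k) q'"
    if "q' \<in> S8 (config x)" "mult_ge (config x) 1 G k q'" for k q'
    using mult_ge_mult[OF that(1) G(2,2,1,1) that(2,2)] .
  have FGm: "mult_ge (config x) (d + (1 + 1)) (F * (G * G)) (k + k') q'"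
    if "q' \<in> S8 (config x)" "mult_ge (config x) d F k q'" "mult_ge (config x) (1 + 1) (G * G) k' q'" for k k' q'
    using mult_ge_mult[OF that(1) F(2) GG(1) F(1) GG(2) that(2,3)] .
  have "is_section (config x) (d + (1 + 1)) (F * (G * G))"
    unfolding is_section_def
  proof (intro conjI ballI)
    show "F * (G * G) \<noteq> 0" using F G by simp
    show "homog (3 * (d + (1 + 1))) (F * (G * G))"
      using homog_mult[OF F(2) GG(1)] by (simp add: algebra_simps)
    fix i :: nat assume i: "i \<in> {1..8}"
    show "d + (1 + 1) \<le> curve_mult (F * (G * G)) (config x i)"
      by (rule curve_mult_mult_ge[OF normalized_config F(2) GG(1) F(1) GG(2) F(3)[OF i]
        curve_mult_mult_ge[OF normalized_config G(2,2,1,1) Gi[OF i] Gi[OF i]]])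
  qed
  moreover have "mult_ge (config x) (d + (1 + 1)) (F * (G * G)) 0 q'" if "q' \<in> S8 (config x)" for q'
    using FGm[OF that F0[OF that] GGm[OF that G0[OF that]]] by simp
  moreover have "mult_ge (config x) (d + (1 + 1)) (F * (G * G)) 2 q'" if "q' \<in> insert q Z" for q'
  proof -
    have q': "q' \<in> S8 (config x)" using that insert.prems by blast
    show ?thesis
    proof (cases "q' = q")
      case True
      then show ?thesis using FGm[OF q' F0[OF q'] GGm[OF q', of 1]] G(4) by (simp add: numeral_2_eq_2)
    next
      case False
      then show ?thesis using FGm[OF q' FZ GGm[OF q' G0[OF q']]] that by simp
    qed
  qed
  ultimately show ?case by blast
qed

lemma double_cubic_imp_nodal:
  assumes gen: "unisolvent line_monomials x" "unisolvent conic_monomials x" "unisolvent nodal_monomials x"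
    and Z: "Z \<subseteq> S8 (config x)" "Z \<noteq> {}"
    and sec: "is_section (config x) 1 F" and mult: "\<And>q. q \<in> Z \<Longrightarrow> 2 \<le> div_mult (config x) 1 F q"
  shows "\<exists>p. Z = {Pt p} \<and> irreducible F \<and> (\<forall>i\<in>{1..8}. peval F (config x i) = 0) \<and> 2 \<le> curve_mult F p"
proof -
  have F: "F \<noteq> 0" "homog 3 F" using sec by (auto simp: is_section_def)
  have Fi: "peval F (config x i) = 0" if "i \<in> {1..8}" for i
    using sec that curve_mult_ge_1_iff[OF normalized_config F(2,1)] by (auto simp: is_section_def)
  obtain D S where D: "cubic_expansion F D S" using cubic_expansion_exists[OF F(2)] by blast
  obtain v where v: "peval F v \<noteq> 0" using exists_peval_nonzero[OF F(2,1)] by blast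
  have nsplit: "\<not> splits F" using not_splits_if_general[OF gen(1,2) v Fi] .
  have "Ex i L \<notin> Z" for i L
  proof
    assume q: "Ex i L \<in> Z"
    then have i: "i \<in> {1..8}" and L: "normalized L" "dot3 L (config x i) = 0"
      using Z(1) by (auto simp: S8_def)
    let ?P = "config x i"
    obtain R B where RB: "det3 ?P R B \<noteq> 0"
      "\<And>F. exc_ord F ?P L = ord2 (\<lambda>x t. peval F (vadd ?P (vadd (vscale x R) (vscale (x * t) B))))"
      using exc_chart[OF cc_config(3) L] by blast
    \<comment> \<open>\<open>div_mult\<close> subtracts \<open>d = 1\<close> from the order, so
      multiplicity at least 2 means order at least 3.\<close>
    have "3 \<le> exc_ord F ?P L" using mult[OF q] by simp
    then have z: "peval F ?P = 0" "D ?P R = 0" "D ?P B = 0"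
      using exc_ord_ge_iff(2)[OF _ L F(2,1) D RB] by auto
    then have "D ?P w = 0" for w using singular_if_frame[OF D RB(1)] by blast
    then show False using not_singular_at_base_point[OF gen(3) i F(2,1) Fi D] by blast
  qed
  then have Pt: "\<exists>p. q = Pt p \<and> normalized p \<and> 2 \<le> curve_mult F p" if "q \<in> Z" for q
    using that mult[OF that] Z(1) by (cases q) (auto simp: S8_def)
  have unique: "p = q" if "normalized p" "2 \<le> curve_mult F p" "normalized q" "2 \<le> curve_mult F q" for p q
  proof (rule ccontr)
    assume "p \<noteq> q"
    from normalized_not_parallel[OF that(1,3) this] obtain r where r: "det3 p q r \<noteq> 0" ..
    note sp = curve_mult_ge_2D[OF that(1) F(2,1) that(2) D]
    note sq = curve_mult_ge_2D[OF that(3) F(2,1) that(4) D]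
    show False using two_singular_points_splits[OF D sp sq r] nsplit by blast
  qed
  obtain q where "q \<in> Z" using Z(2) by blast
  then obtain p where p: "Pt p \<in> Z" "normalized p" "2 \<le> curve_mult F p" using Pt by blast
  then have "Z = {Pt p}" using Pt unique by blast
  moreover have "irreducible F" using reducible_cubic_splits[OF F(2,1)] nsplit by blast
  ultimately show ?thesis using Fi p(3) by blast
qed

text \<open>Degree 0 is excluded because its sections are nonzero constants, which have no zero at
  \<open>p\<close>.\<close>

lemma alpha_eq_1I:
  assumes p: "normalized p" and m: "m \<ge> 1" and F: "is_section Ps 1 F" "m \<le> curve_mult F p"
  shows "alpha Ps m {Pt p} = 1"
  unfolding alpha_def
proof (rule Least_equality)
  show "\<exists>F. is_section Ps 1 F \<and> (\<forall>q\<in>{Pt p}. m \<le> div_mult Ps 1 F q)" using F by auto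
next
  fix d assume "\<exists>F. is_section Ps d F \<and> (\<forall>q\<in>{Pt p}. m \<le> div_mult Ps d F q)"
  then obtain G where G: "is_section Ps d G" "m \<le> curve_mult G p" by auto
  show "1 \<le> d"
  proof (rule ccontr)
    assume "\<not> 1 \<le> d"
    then have "d = 0" by simp
    then have G0: "homog 0 G" "G \<noteq> 0" using G(1) by (simp_all add: is_section_def)
    \<comment> \<open>Scaling a form of degree 0 by 0 multiplies its values by
      \<open>0 ^ 0 = 1\<close>, and all vectors scale to the same one.\<close>
    have const: "peval G (vscale 0 v) = peval G v" for v using peval_vscale[OF G0(1)] by simp
    have "vscale 0 v = vscale 0 w" for v w by (simp add: cvec_eq_iff)
    then have "peval G v = peval G p" for v using const by metis
    moreover have "peval G p = 0"
      using curve_mult_ge_1_iff[OF p G0] G(2) m by simp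
    ultimately show False using exists_peval_nonzero[OF G0] by simp
  qed
qed

theorem theorem13:
  shows "\<exists>g :: mpoly. g \<noteq> 0 \<and> (\<forall>m\<in>Poly_Mapping.keys g. Poly_Mapping.keys m \<subseteq> {2..17}) \<and>
    (\<forall>x :: nat \<Rightarrow> complex. meval g x \<noteq> 0 \<longrightarrow>
      (\<forall>Z. Z \<subseteq> S8 (config x) \<and> finite Z \<and> Z \<noteq> {} \<longrightarrow>
        ((alpha (config x) 1 Z = 1 \<and> alpha (config x) 2 Z = 1) \<longleftrightarrow>
         (\<exists>p. Z = {Pt p} \<and> Pt p \<in> S8 (config x) \<and>
            (\<exists>F. homog 3 F \<and> irreducible F \<and>
                 (\<forall>i\<in>{1..8}. peval F (config x i) = 0) \<and> 2 \<le> curve_mult F p)))))"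
proof -
  have "\<exists>g. g \<noteq> 0 \<and> vars_in {2..17} g \<and> (\<forall>x. meval g x \<noteq> 0 \<longrightarrow> unisolvent line_monomials x)"
    \<comment> \<open>The numeral types 2, 5 and 7 index the three alternants; all first exponents
      are at most 3, as the base 4 encoding demands.\<close>
    by (rule generic_unisolvent[where 'n = 2]) auto
  then obtain g1 where g1: "g1 \<noteq> 0" "vars_in {2..17} g1" "\<forall>x. meval g1 x \<noteq> 0 \<longrightarrow> unisolvent line_monomials x"
    by (elim exE conjE)
  have "\<exists>g. g \<noteq> 0 \<and> vars_in {2..17} g \<and> (\<forall>x. meval g x \<noteq> 0 \<longrightarrow> unisolvent conic_monomials x)"
    by (rule generic_unisolvent[where 'n = 5]) auto
  then obtain g2 where g2: "g2 \<noteq> 0" "vars_in {2..17} g2" "\<forall>x. meval g2 x \<noteq> 0 \<longrightarrow> unisolvent conic_monomials x"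
    by (elim exE conjE)
  have "\<exists>g. g \<noteq> 0 \<and> vars_in {2..17} g \<and> (\<forall>x. meval g x \<noteq> 0 \<longrightarrow> unisolvent nodal_monomials x)"
    by (rule generic_unisolvent[where 'n = 7]) auto
  then obtain g3 where g3: "g3 \<noteq> 0" "vars_in {2..17} g3" "\<forall>x. meval g3 x \<noteq> 0 \<longrightarrow> unisolvent nodal_monomials x"
    by (elim exE conjE)
  define g where "g = g1 * g2 * g3"
  have "g \<noteq> 0" "vars_in {2..17} g" using g1 g2 g3 by (simp_all add: g_def vars_in_mult)
  moreover have "(alpha (config x) 1 Z = 1 \<and> alpha (config x) 2 Z = 1) \<longleftrightarrow>
      (\<exists>p. Z = {Pt p} \<and> Pt p \<in> S8 (config x) \<and> (\<exists>F. homog 3 F \<and> irreducible F \<and>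
        (\<forall>i\<in>{1..8}. peval F (config x i) = 0) \<and> 2 \<le> curve_mult F p))" (is "?L \<longleftrightarrow> ?R")
    if "meval g x \<noteq> 0" and Z: "Z \<subseteq> S8 (config x)" "finite Z" "Z \<noteq> {}" for x Z
  proof
    have "meval g x = meval g1 x * meval g2 x * meval g3 x"
      by (simp add: g_def meval_eq_ev meval.ev_mult)
    then have gen: "unisolvent line_monomials x" "unisolvent conic_monomials x" "unisolvent nodal_monomials x"
      using that(1) g1(3) g2(3) g3(3) by simp_all
    assume ?L
    let ?Q = "\<lambda>d. \<exists>F. is_section (config x) d F \<and> (\<forall>q\<in>Z. 2 \<le> div_mult (config x) d F q)"
    have "\<exists>d. ?Q d" using exists_section_mult_ge_2[OF Z(2,1)] mult_ge_imp by meson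
    then have "?Q (alpha (config x) 2 Z)" unfolding alpha_def by (rule LeastI_ex)
    then have "?Q 1" using \<open>?L\<close> by (simp only:)
    then obtain F where F: "is_section (config x) 1 F" "\<And>q. q \<in> Z \<Longrightarrow> 2 \<le> div_mult (config x) 1 F q" by blast
    have "homog 3 F" using F(1) by (simp add: is_section_def)
    then show ?R using double_cubic_imp_nodal[OF gen Z(1,3) F] Z(1) by blast
  next
    assume ?R
    then obtain p F where p: "Z = {Pt p}" "Pt p \<in> S8 (config x)"
      and F: "homog 3 F" "irreducible F" "\<forall>i\<in>{1..8}. peval F (config x i) = 0" "2 \<le> curve_mult F p" by blast
    have "F \<noteq> 0" using F(2) by auto
    have "1 \<le> curve_mult F (config x i)" if "i \<in> {1..8}" for i
      using curve_mult_ge_1_iff[OF normalized_config F(1) \<open>F \<noteq> 0\<close>] F(3) that by simp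
    then have "is_section (config x) 1 F" using F(1) \<open>F \<noteq> 0\<close> by (simp add: is_section_def)
    moreover have "normalized p" using p(2) by (auto simp: S8_def)
    \<comment> \<open>One cubic serves both values, since multiplicity 2 at \<open>p\<close>
      includes multiplicity 1.\<close>
    ultimately show ?L unfolding p(1) using F(4) by (intro conjI alpha_eq_1I[where F = F]) auto
  qed
  ultimately show ?thesis unfolding vars_in_def by (intro exI[of _ g]) blast
qed

end
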